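(* Let $R=k[x,y]$ be a polynomial ring over an infinite field $k$, and let $I$ be an $R$-ideal generated by monomials of the same degree. Write $I=\mu\,(x^n,y^n,x^{n-k_1}y^{k_1},\ldots,x^{n-k_s}y^{k_s})$ with $\mu$ a monomial and $0<k_1<\cdots<k_s<n$ integers, and set $\delta=\gcd(k_1,\ldots,k_s,n)$. Then $$\mathrm{core}(I)=\mu\,(x^\delta,y^\delta)^{2\frac{n}{\delta}-1}.$$
   Context: A subideal $J$ of an ideal $I$ is a reduction of $I$ if $I^{r+1}=JI^r$ for some integer $r\ge0$. $\mathrm{core}(I)$ is the intersection of all reductions of $I$. *)

theory Defs
  imports "HOL-Algebra.Algebraic_Closure_Type" "HOL-Algebra.Ideal_Product"
begin

text \<open>
  The ring $k[x,y]$ is the type \<open>'k poly poly\<close>, read as $k[x][y]$: the variable $x$ is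
  the inner indeterminate, embedded as a constant polynomial, and $y$ is the outer one.
\<close>

abbreviation bipoly_ring :: "'k::field poly poly ring" where
  "bipoly_ring \<equiv> ring_of_type_algebra"

definition var_x :: "'k::field poly poly" where
  "var_x = [:[:0, 1:]:]"

definition var_y :: "'k::field poly poly" where
  "var_y = [:0, 1:]"

text \<open>Zeroth power is the unit ideal, i.e. the whole ring.\<close>

abbreviation ideal_power :: "('a, 'b) ring_scheme \<Rightarrow> 'a set \<Rightarrow> nat \<Rightarrow> 'a set" where
  "ideal_power R I r \<equiv> I [^]\<^bsub>ideals_set R\<^esub> r"

definition is_reduction :: "('a, 'b) ring_scheme \<Rightarrow> 'a set \<Rightarrow> 'a set \<Rightarrow> bool" where
  "is_reduction R I J \<longleftrightarrow>
     ideal J R \<and> J \<subseteq> I \<and>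
     (\<exists>r::nat. ideal_power R I (r + 1) = J \<cdot>\<^bsub>R\<^esub> ideal_power R I r)"

text \<open>
  An ideal is a reduction of itself (take $r = 0$), so the intersection below is never over
  the empty family.
\<close>

definition core :: "('a, 'b) ring_scheme \<Rightarrow> 'a set \<Rightarrow> 'a set" where
  "core R I = \<Inter>{J. is_reduction R I J}"

end

theory Submission
  imports Defs "HOL-Number_Theory.Cong"
begin

text \<open>
  Put \<open>X = x^\<delta>\<close>, \<open>Y = y^\<delta>\<close>, \<open>N = n / \<delta>\<close>; the exponents \<open>k\<^sub>i / \<delta>\<close> together with \<open>0\<close> and \<open>N\<close> form
  a set \<open>K\<close> with greatest common divisor \<open>1\<close>, and \<open>\<mu>\<close> cancels.

  If \<open>J\<close> is a reduction, the degree-\<open>N\<close> forms in \<open>X, Y\<close> occurring in \<open>J\<close> generate the unit ideal of \<open>k[Y]\<close>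
  after setting \<open>X = 1\<close>, and one of them has full degree. Division with remainder then puts every form
  of degree \<open>2N - 1\<close> into \<open>J\<close> up to monomials of higher degree, and \<open>J\<close> contains all monomials of
  large degree.

  Conversely, \<open>(Y^N - c X^N, X^N - \<sigma> V)\<close> is a reduction for every combination \<open>V\<close> of the generators, every \<open>c\<close>
  and almost all \<open>\<sigma>\<close>. Setting \<open>X = 1\<close>, a form \<open>H\<close> of degree at most \<open>2N - 2\<close> in such an ideal satisfies
  \<open>\<tau>(H (1 - \<sigma> V)\<^sup>-\<^sup>1) = 0\<close>, where \<open>\<tau>\<close> is the coefficient of \<open>Y^(N-1)\<close> modulo \<open>Y^N - c\<close>. Expanding in \<open>\<sigma>\<close>
  gives \<open>\<tau>(H V^l) = 0\<close> for all \<open>l\<close>, and polarising in the coefficients of \<open>V\<close> gives \<open>\<tau>(H Y^e) = 0\<close> whenever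
  \<open>e\<close> is a sum of elements of \<open>K\<close> with multinomial coefficient nonzero in \<open>k\<close>. Such \<open>e\<close> meet every residue
  class modulo \<open>N\<close>, so \<open>H = 0\<close>.
\<close>

section \<open>Ideals of a type-class ring\<close>

lemma ring_of_type_algebra_simps [simp]:
  "carrier ring_of_type_algebra = UNIV"
  "x \<otimes>\<^bsub>ring_of_type_algebra\<^esub> y = x * y"
  "\<one>\<^bsub>ring_of_type_algebra\<^esub> = 1"
  "\<zero>\<^bsub>ring_of_type_algebra\<^esub> = 0"
  "x \<oplus>\<^bsub>ring_of_type_algebra\<^esub> y = x + y"
  by (auto simp: ring_of_type_algebra_def fun_eq_iff)

text \<open>Negatives come from the scalar -1, so closure under sums and multiples suffices. Later
  membership proofs unfold this elementwise form.\<close>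

lemma ideal_type_iff:
  fixes J :: "'a::comm_ring_1 set"
  shows "ideal J ring_of_type_algebra \<longleftrightarrow>
    0 \<in> J \<and> (\<forall>a\<in>J. \<forall>b\<in>J. a + b \<in> J) \<and> (\<forall>a\<in>J. \<forall>r. r * a \<in> J)" (is "?L \<longleftrightarrow> ?R")
proof
  interpret cring "ring_of_type_algebra :: 'a ring" by (rule cring_from_type_algebra)
  assume ?L
  then show ?R
    using additive_subgroup.zero_closed[of J ring_of_type_algebra]
      additive_subgroup.a_closed[of J ring_of_type_algebra]
      ideal.I_l_closed[of J ring_of_type_algebra]
    by (auto simp: ideal.axioms(1))
next
  interpret cring "ring_of_type_algebra :: 'a ring" by (rule cring_from_type_algebra)
  assume R: ?R
  show ?L
  proof (rule idealI)
    show "Ring.ring (ring_of_type_algebra :: 'a ring)" by (rule ring_axioms)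
    show "subgroup J (add_monoid ring_of_type_algebra)"
    proof
      fix x assume x: "x \<in> J"
      have "inv\<^bsub>add_monoid ring_of_type_algebra\<^esub> x = - x"
        using minus_equality[of "- x" x] unfolding a_inv_def by simp
      then show "inv\<^bsub>add_monoid ring_of_type_algebra\<^esub> x \<in> J"
        using R x by (metis mult_minus1)
    qed (use R in auto)
  qed (use R in \<open>auto simp: mult.commute\<close>)
qed

lemma ideal_sum_mem:
  fixes J :: "'a::comm_ring_1 set"
  assumes "ideal J ring_of_type_algebra" "\<And>i. i \<in> A \<Longrightarrow> f i \<in> J"
  shows "sum f A \<in> J"
  using assms(2) by (induction A rule: infinite_finite_induct)
    (use assms(1) in \<open>auto simp: ideal_type_iff\<close>)

lemma ideal_diff_mem:
  fixes J :: "'a::comm_ring_1 set"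
  assumes "ideal J ring_of_type_algebra" "a \<in> J" "b \<in> J"
  shows "a - b \<in> J"
proof -
  have "(-1) * b \<in> J" using assms by (simp only: ideal_type_iff)
  then have "a + (-1) * b \<in> J" using assms by (simp only: ideal_type_iff)
  then show ?thesis by simp
qed

lemma ideal_Idl [simp]:
  fixes S :: "'a::comm_ring_1 set"
  shows "ideal (Idl\<^bsub>ring_of_type_algebra\<^esub> S) ring_of_type_algebra"
proof -
  interpret cring "ring_of_type_algebra :: 'a ring" by (rule cring_from_type_algebra)
  show ?thesis by (rule genideal_ideal) simp
qed

lemma Idl_mem:
  fixes S :: "'a::comm_ring_1 set"
  shows "a \<in> S \<Longrightarrow> a \<in> Idl\<^bsub>ring_of_type_algebra\<^esub> S"
  by (auto simp: genideal_def)

lemma Idl_subset: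
  fixes S :: "'a::comm_ring_1 set"
  shows "ideal J ring_of_type_algebra \<Longrightarrow> S \<subseteq> J \<Longrightarrow> Idl\<^bsub>ring_of_type_algebra\<^esub> S \<subseteq> J"
  by (auto simp: genideal_def)

lemma ideal_prod_ideal [simp]:
  fixes I J :: "'a::comm_ring_1 set"
  assumes "ideal I ring_of_type_algebra" "ideal J ring_of_type_algebra"
  shows "ideal (I \<cdot>\<^bsub>ring_of_type_algebra\<^esub> J) ring_of_type_algebra"
proof -
  interpret cring "ring_of_type_algebra :: 'a ring" by (rule cring_from_type_algebra)
  show ?thesis by (rule ideal_prod_is_ideal[OF assms])
qed

lemma ideal_prod_mem:
  fixes I J :: "'a::comm_ring_1 set"
  assumes "a \<in> I" "b \<in> J"
  shows "a * b \<in> I \<cdot>\<^bsub>ring_of_type_algebra\<^esub> J"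
  using ideal_prod.prod[OF assms, of ring_of_type_algebra] by simp

lemma ideal_prod_subset:
  fixes I J L :: "'a::comm_ring_1 set"
  assumes "\<And>a b. a \<in> L \<Longrightarrow> b \<in> L \<Longrightarrow> a + b \<in> L"
    and "\<And>a b. a \<in> I \<Longrightarrow> b \<in> J \<Longrightarrow> a * b \<in> L"
  shows "I \<cdot>\<^bsub>ring_of_type_algebra\<^esub> J \<subseteq> L"
proof
  fix x assume "x \<in> I \<cdot>\<^bsub>ring_of_type_algebra\<^esub> J"
  then show "x \<in> L" by (induction rule: ideal_prod.induct) (use assms in auto)
qed

text \<open>\<open>L\<close> is only closed under addition, yet the \<open>z\<close> with
  \<open>h * z \<in> L\<close> for all \<open>h \<in> J\<close> form an ideal, because a scalar can
  be moved into \<open>h\<close>. Testing the generators \<open>S\<close> is therefore enough even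
  when \<open>L\<close> is an additive group cut out by conditions on coefficients.\<close>

lemma ideal_prod_Idl_subset:
  fixes J L :: "'a::comm_ring_1 set"
  assumes J: "ideal J ring_of_type_algebra"
    and L0: "0 \<in> L" and add: "\<And>a b. a \<in> L \<Longrightarrow> b \<in> L \<Longrightarrow> a + b \<in> L"
    and mul: "\<And>a s. a \<in> J \<Longrightarrow> s \<in> S \<Longrightarrow> a * s \<in> L"
  shows "J \<cdot>\<^bsub>ring_of_type_algebra\<^esub> (Idl\<^bsub>ring_of_type_algebra\<^esub> S) \<subseteq> L"
proof (rule ideal_prod_subset[OF add])
  have "Idl\<^bsub>ring_of_type_algebra\<^esub> S \<subseteq> {z. \<forall>h\<in>J. h * z \<in> L}"
  proof (rule Idl_subset)
    have "h * (r * z) \<in> L" if "\<forall>h\<in>J. h * z \<in> L" "h \<in> J" for h r z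
    proof -
      have "r * h \<in> J" using J that by (simp add: ideal_type_iff)
      then show ?thesis using that(1) by (metis mult.assoc mult.commute)
    qed
    then show "ideal {z. \<forall>h\<in>J. h * z \<in> L} ring_of_type_algebra"
      by (auto simp: ideal_type_iff L0 distrib_left add)
  qed (use mul in auto)
  then show "a * b \<in> L" if "a \<in> J" "b \<in> Idl\<^bsub>ring_of_type_algebra\<^esub> S" for a b using that by auto
qed

lemma ideal_prod_Idl:
  fixes S U :: "'a::comm_ring_1 set"
  shows "(Idl\<^bsub>ring_of_type_algebra\<^esub> S) \<cdot>\<^bsub>ring_of_type_algebra\<^esub> (Idl\<^bsub>ring_of_type_algebra\<^esub> U)
    = Idl\<^bsub>ring_of_type_algebra\<^esub> {a * b | a b. a \<in> S \<and> b \<in> U}" (is "?L = ?R")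
proof
  have R: "ideal ?R ring_of_type_algebra" by simp
  have 1: "Idl\<^bsub>ring_of_type_algebra\<^esub> S \<subseteq> {a. \<forall>b\<in>U. a * b \<in> ?R}"
  proof (rule Idl_subset)
    have "\<And>r a b. a * b \<in> ?R \<Longrightarrow> r * a * b \<in> ?R"
      using R by (simp add: ideal_type_iff mult.assoc)
    then show "ideal {a. \<forall>b\<in>U. a * b \<in> ?R} ring_of_type_algebra"
      using R by (simp add: ideal_type_iff distrib_right)
  qed (auto intro!: Idl_mem)
  show "?L \<subseteq> ?R"
  proof (rule ideal_prod_Idl_subset)
    show "0 \<in> ?R" "\<And>a b. a \<in> ?R \<Longrightarrow> b \<in> ?R \<Longrightarrow> a + b \<in> ?R"
      using R unfolding ideal_type_iff by blast+
  qed (use 1 in auto)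
  show "?R \<subseteq> ?L"
    by (intro Idl_subset) (auto intro!: ideal_prod_mem Idl_mem)
qed

section \<open>Powers of ideals\<close>

lemma ideals_set_simps [simp]:
  "\<one>\<^bsub>ideals_set R\<^esub> = carrier R"
  "I \<otimes>\<^bsub>ideals_set R\<^esub> J = I \<cdot>\<^bsub>R\<^esub> J"
  by (simp_all add: ideals_set_def)

lemma ideal_power_0 [simp]:
  fixes I :: "'a::comm_ring_1 set"
  shows "ideal_power ring_of_type_algebra I 0 = UNIV"
  by (simp add: ideals_set_def)

lemma ideal_power_Suc [simp]:
  fixes I :: "'a::comm_ring_1 set"
  shows "ideal_power ring_of_type_algebra I (Suc r) =
    ideal_power ring_of_type_algebra I r \<cdot>\<^bsub>ring_of_type_algebra\<^esub> I"
  by (simp add: ideals_set_def)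

lemma ideal_power_ideal [simp]:
  fixes I :: "'a::comm_ring_1 set"
  assumes "ideal I ring_of_type_algebra"
  shows "ideal (ideal_power ring_of_type_algebra I r) ring_of_type_algebra"
  by (induction r) (use assms in \<open>auto simp: ideal_type_iff[of UNIV]\<close>)

lemma ideal_prod_comm:
  fixes I J :: "'a::comm_ring_1 set"
  assumes "ideal I ring_of_type_algebra" "ideal J ring_of_type_algebra"
  shows "I \<cdot>\<^bsub>ring_of_type_algebra\<^esub> J = J \<cdot>\<^bsub>ring_of_type_algebra\<^esub> I"
proof -
  interpret cring "ring_of_type_algebra :: 'a ring" by (rule cring_from_type_algebra)
  show ?thesis by (rule ideal_prod_commute[OF assms])
qed

lemma ideal_power_mult_mem:
  fixes I :: "'a::comm_ring_1 set"
  assumes I: "ideal I ring_of_type_algebra"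
    and "a \<in> ideal_power ring_of_type_algebra I r" "b \<in> ideal_power ring_of_type_algebra I q"
  shows "a * b \<in> ideal_power ring_of_type_algebra I (r + q)"
  using assms(3)
proof (induction q arbitrary: b)
  case 0
  have "ideal (ideal_power ring_of_type_algebra I r) ring_of_type_algebra" using I by simp
  then have "b * a \<in> ideal_power ring_of_type_algebra I r"
    using assms(2) by (simp only: ideal_type_iff)
  then show ?case by (simp add: mult.commute)
next
  case (Suc q)
  let ?P = "ideal_power ring_of_type_algebra I"
  have "?P q \<cdot>\<^bsub>ring_of_type_algebra\<^esub> I \<subseteq> {b. a * b \<in> ?P (r + Suc q)}"
  proof (rule ideal_prod_subset)
    fix u v assume "u \<in> ?P q" "v \<in> I"
    then have "(a * u) * v \<in> ?P (r + q) \<cdot>\<^bsub>ring_of_type_algebra\<^esub> I"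
      by (intro ideal_prod_mem Suc.IH)
    then show "u * v \<in> {b. a * b \<in> ?P (r + Suc q)}" by (simp add: mult.assoc)
  next
    have "ideal (?P (r + Suc q)) ring_of_type_algebra" using I by (rule ideal_power_ideal)
    then show "\<And>u v. u \<in> {b. a * b \<in> ?P (r + Suc q)} \<Longrightarrow> v \<in> {b. a * b \<in> ?P (r + Suc q)} \<Longrightarrow>
      u + v \<in> {b. a * b \<in> ?P (r + Suc q)}"
      by (simp only: ideal_type_iff mem_Collect_eq distrib_left)
  qed
  then show ?case using Suc.prems by auto
qed

lemma ideal_power_power_mem:
  fixes I :: "'a::comm_ring_1 set"
  assumes "ideal I ring_of_type_algebra" "a \<in> I"
  shows "a ^ r \<in> ideal_power ring_of_type_algebra I r"
  by (induction r) (auto simp del: power_Suc simp: power_Suc2 intro: ideal_prod_mem assms)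

lemma ideal_prod_power_mult_mem:
  fixes I J :: "'a::comm_ring_1 set"
  assumes I: "ideal I ring_of_type_algebra" and J: "ideal J ring_of_type_algebra"
    and a: "a \<in> J \<cdot>\<^bsub>ring_of_type_algebra\<^esub> ideal_power ring_of_type_algebra I r"
    and b: "b \<in> ideal_power ring_of_type_algebra I q"
  shows "a * b \<in> J \<cdot>\<^bsub>ring_of_type_algebra\<^esub> ideal_power ring_of_type_algebra I (r + q)"
proof -
  let ?P = "ideal_power ring_of_type_algebra I"
  let ?L = "J \<cdot>\<^bsub>ring_of_type_algebra\<^esub> ?P (r + q)"
  have "ideal ?L ring_of_type_algebra" using I J by (intro ideal_prod_ideal ideal_power_ideal)
  moreover have "u * v * b \<in> ?L" if "u \<in> J" "v \<in> ?P r" for u v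
    using ideal_prod_mem[OF that(1) ideal_power_mult_mem[OF I that(2) b]] by (simp add: mult.assoc)
  ultimately have "J \<cdot>\<^bsub>ring_of_type_algebra\<^esub> ?P r \<subseteq> {z. z * b \<in> ?L}"
    by (intro ideal_prod_subset) (auto simp only: ideal_type_iff distrib_right mem_Collect_eq)
  then show ?thesis using a by auto
qed

section \<open>Reductions and the core\<close>

lemma l_coset_type_eq: "a <#\<^bsub>ring_of_type_algebra\<^esub> I = (*) a ` I"
  by (auto simp: l_coset_def)

lemma ideal_scale [simp]:
  fixes I :: "'a::comm_ring_1 set"
  assumes "ideal I ring_of_type_algebra"
  shows "ideal ((*) a ` I) ring_of_type_algebra"
proof -
  have "0 \<in> (*) a ` I" using assms by (auto simp: ideal_type_iff image_iff intro!: bexI[of _ 0])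
  moreover have "a * u + a * v \<in> (*) a ` I" if "u \<in> I" "v \<in> I" for u v
    using that assms by (auto simp: ideal_type_iff image_iff intro!: bexI[of _ "u + v"] simp: distrib_left)
  moreover have "r * (a * u) \<in> (*) a ` I" if "u \<in> I" for u r
    using that assms by (auto simp: ideal_type_iff image_iff intro!: bexI[of _ "r * u"] simp: mult_ac)
  ultimately show ?thesis by (auto simp: ideal_type_iff)
qed

lemma ideal_prod_scale:
  fixes I J :: "'a::comm_ring_1 set"
  shows "((*) a ` I) \<cdot>\<^bsub>ring_of_type_algebra\<^esub> ((*) b ` J) =
    (*) (a * b) ` (I \<cdot>\<^bsub>ring_of_type_algebra\<^esub> J)" (is "?L = ?R")
proof
  show "?L \<subseteq> ?R"
  proof (rule ideal_prod_subset)
    fix u v assume "u \<in> ?R" "v \<in> ?R"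
    then obtain u' v' where u': "u' \<in> I \<cdot>\<^bsub>ring_of_type_algebra\<^esub> J" "u = a * b * u'"
      and v': "v' \<in> I \<cdot>\<^bsub>ring_of_type_algebra\<^esub> J" "v = a * b * v'" by blast
    from ideal_prod.sum[OF u'(1) v'(1)] have "u' + v' \<in> I \<cdot>\<^bsub>ring_of_type_algebra\<^esub> J" by simp
    moreover have "u + v = a * b * (u' + v')" using u' v' by (simp add: distrib_left)
    ultimately show "u + v \<in> ?R" by blast
  next
    fix u v assume "u \<in> (*) a ` I" "v \<in> (*) b ` J"
    then obtain u' v' where uv: "u' \<in> I" "u = a * u'" "v' \<in> J" "v = b * v'" by blast
    then have "u * v = a * b * (u' * v')" by (simp add: mult_ac)
    then show "u * v \<in> ?R" using ideal_prod_mem[OF uv(1,3)] by blast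
  qed
  have "I \<cdot>\<^bsub>ring_of_type_algebra\<^esub> J \<subseteq> {z. a * b * z \<in> ?L}"
  proof (rule ideal_prod_subset)
    fix u v assume uv: "u \<in> {z. a * b * z \<in> ?L}" "v \<in> {z. a * b * z \<in> ?L}"
    then have "a * b * u + a * b * v \<in> ?L"
      using ideal_prod.sum[of "a * b * u" ring_of_type_algebra _ _ "a * b * v"] by simp
    then show "u + v \<in> {z. a * b * z \<in> ?L}" by (simp add: distrib_left)
  next
    fix u v assume "u \<in> I" "v \<in> J"
    then have "(a * u) * (b * v) \<in> ?L" by (intro ideal_prod_mem) auto
    then show "u * v \<in> {z. a * b * z \<in> ?L}" by (simp add: mult_ac)
  qed
  then show "?R \<subseteq> ?L" by blast
qed

lemma ideal_power_scale:
  fixes I :: "'a::comm_ring_1 set"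
  shows "ideal_power ring_of_type_algebra ((*) a ` I) r =
    (*) (a ^ r) ` ideal_power ring_of_type_algebra I r"
proof (induction r)
  case 0
  show ?case by (auto simp: image_iff)
next
  case (Suc r)
  have "ideal_power ring_of_type_algebra ((*) a ` I) (Suc r) =
    (*) (a ^ r * a) ` (ideal_power ring_of_type_algebra I r \<cdot>\<^bsub>ring_of_type_algebra\<^esub> I)"
    unfolding ideal_power_Suc Suc.IH ideal_prod_scale ..
  then show ?case by (simp add: mult.commute)
qed

lemma is_reduction_refl:
  fixes I :: "'a::comm_ring_1 set"
  assumes "ideal I ring_of_type_algebra"
  shows "is_reduction ring_of_type_algebra I I"
  unfolding is_reduction_def
proof (intro conjI exI[of _ 0])
  show "ideal_power ring_of_type_algebra I (0 + 1) =
      I \<cdot>\<^bsub>ring_of_type_algebra\<^esub> ideal_power ring_of_type_algebra I 0"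
    using ideal_prod_comm[OF assms, of UNIV] by (simp add: ideal_type_iff)
qed (use assms in auto)

text \<open>Both sides of the reduction equation acquire the same factor \<open>a ^ (r + 1)\<close>,
  which cancels because multiplication by a nonzero element of a domain is injective.\<close>

lemma is_reduction_scale_iff:
  fixes I J :: "'a::idom set"
  assumes "a \<noteq> 0" "ideal J ring_of_type_algebra"
  shows "is_reduction ring_of_type_algebra ((*) a ` I) ((*) a ` J) \<longleftrightarrow>
    is_reduction ring_of_type_algebra I J"
proof -
  have inj: "inj ((*) c)" if "c \<noteq> 0" for c :: 'a using that by (auto intro: injI)
  have "(*) a ` J \<cdot>\<^bsub>ring_of_type_algebra\<^esub> ideal_power ring_of_type_algebra ((*) a ` I) r =
    (*) (a ^ (r + 1)) ` (J \<cdot>\<^bsub>ring_of_type_algebra\<^esub> ideal_power ring_of_type_algebra I r)" for r :: nat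
    unfolding ideal_power_scale ideal_prod_scale by simp
  then show ?thesis
    unfolding is_reduction_def ideal_power_scale
    using assms ideal_scale[OF assms(2), of a]
    by (simp add: inj_image_eq_iff[OF inj] inj_image_subset_iff[OF inj] del: ideal_power_Suc)
qed

text \<open>A reduction \<open>J'\<close> of the scaled ideal lies inside that ideal, so it is the
  scaling of \<open>{u. a * u \<in> J'}\<close>. Hence the reductions of both ideals correspond, and
  intersections are compared after cancelling \<open>a\<close>.\<close>

lemma core_scale:
  fixes I :: "'a::idom set"
  assumes a: "a \<noteq> 0" and I: "ideal I ring_of_type_algebra"
  shows "core ring_of_type_algebra ((*) a ` I) = (*) a ` core ring_of_type_algebra I"
proof
  show "core ring_of_type_algebra ((*) a ` I) \<subseteq> (*) a ` core ring_of_type_algebra I"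
  proof
    fix z assume z: "z \<in> core ring_of_type_algebra ((*) a ` I)"
    then have "z \<in> (*) a ` I" using is_reduction_refl[OF ideal_scale[OF I]] by (auto simp: core_def)
    then obtain h where h: "z = a * h" by blast
    have "h \<in> J" if J: "is_reduction ring_of_type_algebra I J" for J
    proof -
      have "is_reduction ring_of_type_algebra ((*) a ` I) ((*) a ` J)"
        using J a by (subst is_reduction_scale_iff) (auto simp: is_reduction_def)
      then have "a * h \<in> (*) a ` J" using z h by (auto simp: core_def)
      then show ?thesis using a by auto
    qed
    then show "z \<in> (*) a ` core ring_of_type_algebra I" using h by (auto simp: core_def)
  qed
next
  have "a * h \<in> J'" if h: "h \<in> core ring_of_type_algebra I"
    and J': "is_reduction ring_of_type_algebra ((*) a ` I) J'" for h J'
  proof -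
    define J where "J = {u. a * u \<in> J'}"
    have id': "ideal J' ring_of_type_algebra" and sub: "J' \<subseteq> (*) a ` I"
      using J' by (auto simp: is_reduction_def)
    have J: "ideal J ring_of_type_algebra"
      using id' by (simp add: ideal_type_iff J_def distrib_left mult.left_commute)
    have "J' = (*) a ` J" using sub by (auto simp: J_def)
    then have "is_reduction ring_of_type_algebra I J"
      using J' is_reduction_scale_iff[OF a J] by simp
    then show ?thesis using h by (auto simp: core_def J_def)
  qed
  then show "(*) a ` core ring_of_type_algebra I \<subseteq> core ring_of_type_algebra ((*) a ` I)"
    by (auto simp: core_def)
qed

section \<open>Powers of a finitely generated ideal and a criterion for reductions\<close>

lemma prod_power_mem_ideal_power:
  fixes I :: "'a::comm_ring_1 set"
  assumes "ideal I ring_of_type_algebra" "finite A" "A \<subseteq> I"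
  shows "(\<Prod>g\<in>A. g ^ e g) \<in> ideal_power ring_of_type_algebra I (\<Sum>g\<in>A. e g)"
  using assms(2,3)
proof (induction A)
  case (insert g A)
  then show ?case
    using ideal_power_mult_mem[OF assms(1) ideal_power_power_mem[OF assms(1)]] by simp
qed simp

lemma ideal_power_Idl_subset:
  fixes A :: "'a::comm_ring_1 set"
  assumes "finite A"
  shows "ideal_power ring_of_type_algebra (Idl\<^bsub>ring_of_type_algebra\<^esub> A) r \<subseteq>
    Idl\<^bsub>ring_of_type_algebra\<^esub> {\<Prod>g\<in>A. g ^ e g | e. (\<Sum>g\<in>A. e g) = r}"
proof (induction r)
  case 0
  let ?R = "Idl\<^bsub>ring_of_type_algebra\<^esub> {\<Prod>g\<in>A. g ^ e g | e. (\<Sum>g\<in>A. e g) = 0}"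
  have "(\<Prod>g\<in>A. g ^ (\<lambda>_. 0) g) \<in> ?R"
    by (intro Idl_mem CollectI exI[of _ "\<lambda>_. 0"]) simp
  then have "1 \<in> ?R" by simp
  moreover have "ideal ?R ring_of_type_algebra" by (rule ideal_Idl)
  ultimately have "\<And>x. x * 1 \<in> ?R" unfolding ideal_type_iff by blast
  then show ?case by auto
next
  case (Suc r)
  let ?P = "\<lambda>r. {\<Prod>g\<in>A. g ^ e g | e. (\<Sum>g\<in>A. e g) = r}"
  let ?I = "Idl\<^bsub>ring_of_type_algebra\<^esub> A"
  have "ideal_power ring_of_type_algebra ?I (Suc r) \<subseteq>
      (Idl\<^bsub>ring_of_type_algebra\<^esub> (?P r)) \<cdot>\<^bsub>ring_of_type_algebra\<^esub> ?I"
    unfolding ideal_power_Suc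
  proof (rule ideal_prod_subset)
    show "u + v \<in> (Idl\<^bsub>ring_of_type_algebra\<^esub> (?P r)) \<cdot>\<^bsub>ring_of_type_algebra\<^esub> ?I"
      if "u \<in> (Idl\<^bsub>ring_of_type_algebra\<^esub> (?P r)) \<cdot>\<^bsub>ring_of_type_algebra\<^esub> ?I"
        "v \<in> (Idl\<^bsub>ring_of_type_algebra\<^esub> (?P r)) \<cdot>\<^bsub>ring_of_type_algebra\<^esub> ?I" for u v
      using ideal_prod.sum[OF that] by simp
  qed (use Suc.IH in \<open>auto intro!: ideal_prod_mem\<close>)
  also have "\<dots> = Idl\<^bsub>ring_of_type_algebra\<^esub> {a * b | a b. a \<in> ?P r \<and> b \<in> A}"
    by (rule ideal_prod_Idl)
  also have "\<dots> \<subseteq> Idl\<^bsub>ring_of_type_algebra\<^esub> (?P (Suc r))"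
  proof (rule Idl_subset[OF ideal_Idl], rule subsetI, rule Idl_mem)
    fix z assume "z \<in> {a * b | a b. a \<in> ?P r \<and> b \<in> A}"
    then obtain e b where z: "z = (\<Prod>g\<in>A. g ^ e g) * b" "(\<Sum>g\<in>A. e g) = r" and b: "b \<in> A" by blast
    let ?e = "\<lambda>g. e g + (if g = b then 1 else 0)"
    have "(\<Sum>g\<in>A. ?e g) = Suc r" using z(2) b assms by (simp add: sum.distrib)
    moreover have "(\<Prod>g\<in>A. g ^ ?e g) = z"
    proof -
      have "(\<Prod>g\<in>A. g ^ ?e g) = (\<Prod>g\<in>A. g ^ e g) * (\<Prod>g\<in>A. if g = b then b else 1)"
        unfolding prod.distrib[symmetric] by (rule prod.cong) auto
      then show ?thesis using z(1) b assms by simp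
    qed
    ultimately show "z \<in> ?P (Suc r)" by (intro CollectI exI[of _ ?e]) simp
  qed
  finally show ?case .
qed

text \<open>By pigeonhole, a product of more than \<open>card A * E\<close> generators contains some
  generator more than \<open>E\<close> times.\<close>

lemma is_reductionI_generators:
  fixes A :: "'a::comm_ring_1 set"
  assumes A: "finite A" "I = Idl\<^bsub>ring_of_type_algebra\<^esub> A"
    and J: "ideal J ring_of_type_algebra" "J \<subseteq> I"
    and pow: "\<And>g. g \<in> A \<Longrightarrow> g ^ Suc E \<in> J \<cdot>\<^bsub>ring_of_type_algebra\<^esub> ideal_power ring_of_type_algebra I E"
  shows "is_reduction ring_of_type_algebra I J"
proof -
  let ?P = "ideal_power ring_of_type_algebra I"
  let ?r = "card A * E"
  have I: "ideal I ring_of_type_algebra" "A \<subseteq> I" using A by (auto intro: Idl_mem)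
  have id: "ideal (J \<cdot>\<^bsub>ring_of_type_algebra\<^esub> ?P ?r) ring_of_type_algebra"
    by (intro ideal_prod_ideal J ideal_power_ideal I)
  have sub: "{\<Prod>g\<in>A. g ^ e g | e. (\<Sum>g\<in>A. e g) = ?r + 1} \<subseteq> J \<cdot>\<^bsub>ring_of_type_algebra\<^esub> ?P ?r"
  proof safe
    fix e :: "'a \<Rightarrow> nat" assume e: "(\<Sum>g\<in>A. e g) = ?r + 1"
    obtain g where g: "g \<in> A" "E < e g"
    proof -
      have "\<not> (\<forall>g\<in>A. e g \<le> E)" using sum_bounded_above[of A e E] e by auto
      then show ?thesis using that by auto
    qed
    let ?e = "e(g := e g - Suc E)"
    have 1: "(\<Prod>g\<in>A. g ^ e g) = g ^ Suc E * (\<Prod>g\<in>A. g ^ ?e g)"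
    proof -
      have "g ^ e g = g ^ Suc E * g ^ (e g - Suc E)" using g by (subst power_add[symmetric]) simp
      moreover have "(\<Prod>h\<in>A - {g}. h ^ e h) = (\<Prod>h\<in>A - {g}. h ^ ?e h)" by (rule prod.cong) auto
      ultimately show ?thesis using g A(1) by (simp add: prod.remove[of A g] mult_ac)
    qed
    have 2: "Suc E + (\<Sum>g\<in>A. ?e g) = ?r + 1"
    proof -
      have "(\<Sum>h\<in>A - {g}. e h) = (\<Sum>h\<in>A - {g}. ?e h)" by (rule sum.cong) auto
      then show ?thesis using e g A(1) by (simp add: sum.remove[of A g])
    qed
    \<comment> \<open>The power \<open>g ^ Suc E\<close> supplies the factor in \<open>J\<close> and
      \<open>E\<close> factors from \<open>I\<close>; by \<open>2\<close> the remaining exponents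
      raise the level exactly to \<open>?r\<close>.\<close>
    have "g ^ Suc E * (\<Prod>g\<in>A. g ^ ?e g) \<in>
      J \<cdot>\<^bsub>ring_of_type_algebra\<^esub> ?P (E + (\<Sum>g\<in>A. ?e g))"
      by (intro ideal_prod_power_mult_mem J I pow g prod_power_mem_ideal_power A)
    then show "(\<Prod>g\<in>A. g ^ e g) \<in> J \<cdot>\<^bsub>ring_of_type_algebra\<^esub> ?P ?r"
      using 1 2 by simp
  qed
  have "?P (?r + 1) = J \<cdot>\<^bsub>ring_of_type_algebra\<^esub> ?P ?r"
  proof
    show "?P (?r + 1) \<subseteq> J \<cdot>\<^bsub>ring_of_type_algebra\<^esub> ?P ?r"
      using order_trans[OF ideal_power_Idl_subset[OF A(1)] Idl_subset[OF id sub]] A(2) by blast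
    have Iid: "ideal (?P (?r + 1)) ring_of_type_algebra" by (rule ideal_power_ideal[OF I(1)])
    show "J \<cdot>\<^bsub>ring_of_type_algebra\<^esub> ?P ?r \<subseteq> ?P (?r + 1)"
    proof (rule ideal_prod_subset)
      show "u + v \<in> ?P (?r + 1)" if "u \<in> ?P (?r + 1)" "v \<in> ?P (?r + 1)" for u v
        using Iid that unfolding ideal_type_iff by blast
      show "u * v \<in> ?P (?r + 1)" if "u \<in> J" "v \<in> ?P ?r" for u v
      proof -
        have "v * u \<in> ?P ?r \<cdot>\<^bsub>ring_of_type_algebra\<^esub> I"
          using that J(2) by (intro ideal_prod_mem) auto
        then show ?thesis by (simp add: mult.commute)
      qed
    qed
  qed
  then show ?thesis using J unfolding is_reduction_def by blast
qed

section \<open>Polynomials supported in iterated sumsets\<close>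

text \<open>The \<open>r\<close>-fold sumset \<open>rK\<close>: the exponents of \<open>Y\<close> in
  the monomial generators of the \<open>r\<close>-th power of the ideal whose generators have
  \<open>Y\<close>-exponents \<open>K\<close>.\<close>

primrec sumset_pow :: "nat set \<Rightarrow> nat \<Rightarrow> nat set" where
  "sumset_pow K 0 = {0}"
| "sumset_pow K (Suc r) = {e + k | e k. e \<in> sumset_pow K r \<and> k \<in> K}"

lemma sumset_pow_SucI: "e \<in> sumset_pow K r \<Longrightarrow> k \<in> K \<Longrightarrow> e + k \<in> sumset_pow K (Suc r)"
  by auto

lemma sumset_pow_add:
  "a \<in> sumset_pow K r \<Longrightarrow> b \<in> sumset_pow K q \<Longrightarrow> a + b \<in> sumset_pow K (r + q)"
proof (induction q arbitrary: b)
  case (Suc q)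
  then obtain e k where "b = e + k" "e \<in> sumset_pow K q" "k \<in> K" by auto
  then show ?case using sumset_pow_SucI[of "a + e" K "r + q" k] Suc by (simp add: add.assoc del: sumset_pow.simps)
qed simp

lemma sumset_pow_mono: "0 \<in> K \<Longrightarrow> r \<le> q \<Longrightarrow> sumset_pow K r \<subseteq> sumset_pow K q"
proof (induction q)
  case (Suc q)
  show ?case
  proof (cases "r = Suc q")
    case False
    then have "sumset_pow K r \<subseteq> sumset_pow K q" using Suc by auto
    then show ?thesis using Suc.prems by force
  qed simp
qed simp

lemma sumset_pow_le:
  assumes "K \<subseteq> {..N}" shows "sumset_pow K r \<subseteq> {..N * r}"
proof (induction r)
  case (Suc r)
  show ?case
  proof
    fix x assume "x \<in> sumset_pow K (Suc r)"
    then obtain e k where "x = e + k" "e \<in> sumset_pow K r" "k \<in> K" by auto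
    then have "x \<le> N * r + N" using Suc assms by (auto intro!: add_mono)
    then show "x \<in> {..N * Suc r}" by simp
  qed
qed simp

lemma finite_sumset_pow: "K \<subseteq> {..N} \<Longrightarrow> finite (sumset_pow K r)"
  by (rule finite_subset[OF sumset_pow_le]) auto

lemma zero_mem_sumset_pow: "0 \<in> K \<Longrightarrow> 0 \<in> sumset_pow K r"
  by (induction r) auto

lemma mult_mem_sumset_pow: "k \<in> K \<Longrightarrow> r * k \<in> sumset_pow K r"
proof (induction r)
  case (Suc r)
  then show ?case using sumset_pow_SucI[of "r * k" K r k] by (simp add: add.commute del: sumset_pow.simps)
qed simp

text \<open>The total growth up to \<open>r = N + N\<^sup>2 + 1\<close> is at most \<open>N * r\<close>, so some step is small.\<close>

lemma sumset_pow_growth: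
  assumes K: "K \<subseteq> {..N}" "0 \<in> K"
  shows "\<exists>r\<ge>N. card (sumset_pow K (Suc r)) \<le> card (sumset_pow K r) + N"
proof (rule ccontr)
  assume "\<not> ?thesis"
  then have gr: "card (sumset_pow K r) + N + 1 \<le> card (sumset_pow K (Suc r))" if "r \<ge> N" for r
    using that by force
  have "m * (N + 1) + 1 \<le> card (sumset_pow K (N + m))" for m
  proof (induction m)
    case 0
    have "sumset_pow K N \<noteq> {}" using zero_mem_sumset_pow[OF K(2)] by auto
    then show ?case using finite_sumset_pow[OF K(1)] by (simp add: Suc_le_eq card_gt_0_iff)
  next
    case (Suc m)
    then show ?case using gr[of "N + m"] by simp
  qed
  \<comment> \<open>The choice \<open>m = N * N + 1\<close> makes the lower bound larger by exactly
    one than the \<open>N * (N + m) + 1\<close> numbers available.\<close>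
  then have "(N * N + 1) * (N + 1) + 1 \<le> card (sumset_pow K (N + (N * N + 1)))" .
  also have "\<dots> \<le> card {..N * (N + (N * N + 1))}"
    by (rule card_mono[OF _ sumset_pow_le[OF K(1)]]) simp
  finally show False by (simp add: algebra_simps)
qed

section \<open>Polynomials with prescribed support\<close>

definition polys_on :: "nat set \<Rightarrow> 'k::field poly set" where
  "polys_on S = {p. \<forall>i. Polynomial.coeff p i \<noteq> 0 \<longrightarrow> i \<in> S}"

lemma polys_on_mono: "S \<subseteq> U \<Longrightarrow> p \<in> polys_on S \<Longrightarrow> p \<in> polys_on U"
  by (auto simp: polys_on_def)

lemma polys_on_simps [simp]:
  "0 \<in> polys_on S"
  "p \<in> polys_on S \<Longrightarrow> q \<in> polys_on S \<Longrightarrow> p + q \<in> polys_on S"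
  "p \<in> polys_on S \<Longrightarrow> q \<in> polys_on S \<Longrightarrow> p - q \<in> polys_on S"
  "p \<in> polys_on S \<Longrightarrow> Polynomial.smult c p \<in> polys_on S"
  "i \<in> S \<Longrightarrow> Polynomial.monom c i \<in> polys_on S"
  by (auto simp: polys_on_def) (metis add.right_neutral, metis diff_zero)

lemma polys_on_sum: "(\<And>i. i \<in> A \<Longrightarrow> f i \<in> polys_on S) \<Longrightarrow> sum f A \<in> polys_on S"
  by (induction A rule: infinite_finite_induct) auto

lemma polys_on_mult:
  assumes "p \<in> polys_on (sumset_pow K r)" "q \<in> polys_on (sumset_pow K s)"
  shows "p * q \<in> polys_on (sumset_pow K (r + s))"
proof -
  have "i \<in> sumset_pow K (r + s)" if "Polynomial.coeff (p * q) i \<noteq> 0" for i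
  proof -
    obtain j where j: "j \<le> i" "Polynomial.coeff p j * Polynomial.coeff q (i - j) \<noteq> 0"
      using \<open>Polynomial.coeff (p * q) i \<noteq> 0\<close> unfolding coeff_mult by (meson atMost_iff sum.neutral)
    then have "j \<in> sumset_pow K r" "i - j \<in> sumset_pow K s" using assms by (auto simp: polys_on_def)
    then show ?thesis using sumset_pow_add[of j K r "i - j" s] j by simp
  qed
  then show ?thesis by (auto simp: polys_on_def)
qed

lemma sumset_pow_1: "sumset_pow K (Suc 0) = K"
  by auto

lemma polys_on_power: "p \<in> polys_on K \<Longrightarrow> p ^ r \<in> polys_on (sumset_pow K r)"
proof (induction r)
  case 0
  then show ?case by (simp add: polys_on_def one_pCons coeff_pCons split: nat.splits)
next
  case (Suc r)
  then show ?case
    using polys_on_mult[of p K "Suc 0" "p ^ r" r] unfolding sumset_pow_1 by simp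
qed

text \<open>Gaussian elimination, by induction on the equations: a pivot \<open>a i0 j\<close>
  clears equation \<open>j\<close> from the other unknowns, the smaller system is solved, and
  equation \<open>j\<close> then determines the value at \<open>i0\<close>.\<close>

lemma homogeneous_system:
  fixes a :: "'i \<Rightarrow> 'j \<Rightarrow> 'k::field"
  assumes "finite J" "finite I" "card J < card I"
  shows "\<exists>x. (\<exists>i\<in>I. x i \<noteq> 0) \<and> (\<forall>j\<in>J. (\<Sum>i\<in>I. x i * a i j) = 0)"
  using assms
proof (induction J arbitrary: I a)
  case empty
  then have "I \<noteq> {}" by auto
  then show ?case by (intro exI[of _ "\<lambda>_. 1"]) auto
next
  case (insert j J)
  show ?case
  proof (cases "\<forall>i\<in>I. a i j = 0")
    case True
    have "\<exists>x. (\<exists>i\<in>I. x i \<noteq> 0) \<and> (\<forall>j\<in>J. (\<Sum>i\<in>I. x i * a i j) = 0)"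
      by (rule insert.IH) (use insert in auto)
    then show ?thesis using True by auto
  next
    case False
    then obtain i0 where i0: "i0 \<in> I" "a i0 j \<noteq> 0" by blast
    define a' where "a' i j' = a i j' - a i j / a i0 j * a i0 j'" for i j'
    have "\<exists>x. (\<exists>i\<in>I - {i0}. x i \<noteq> 0) \<and> (\<forall>j\<in>J. (\<Sum>i\<in>I - {i0}. x i * a' i j) = 0)"
      by (rule insert.IH) (use insert i0 in auto)
    then obtain x i1 where i1: "i1 \<in> I - {i0}" "x i1 \<noteq> 0"
      and x: "\<And>j. j \<in> J \<Longrightarrow> (\<Sum>i\<in>I - {i0}. x i * a' i j) = 0" by blast
    define s where "s = (\<Sum>i\<in>I - {i0}. x i * a i j)"
    define y where "y = x(i0 := - s / a i0 j)"
    have sum_y: "(\<Sum>i\<in>I. y i * a i j') = - s / a i0 j * a i0 j' + (\<Sum>i\<in>I - {i0}. x i * a i j')" for j'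
    proof -
      have "(\<Sum>i\<in>I. y i * a i j') = y i0 * a i0 j' + (\<Sum>i\<in>I - {i0}. y i * a i j')"
        using insert.prems i0 by (simp add: sum.remove)
      moreover have "(\<Sum>i\<in>I - {i0}. y i * a i j') = (\<Sum>i\<in>I - {i0}. x i * a i j')"
        by (rule sum.cong) (auto simp: y_def)
      ultimately show ?thesis by (simp add: y_def)
    qed
    have "(\<Sum>i\<in>I. y i * a i j') = 0" if "j' \<in> insert j J" for j'
    proof (cases "j' = j")
      case True
      then show ?thesis using i0 by (simp add: sum_y s_def)
    next
      case False
      then have "0 = (\<Sum>i\<in>I - {i0}. x i * a' i j')" using x that by simp
      also have "\<dots> = (\<Sum>i\<in>I - {i0}. x i * a i j') - (\<Sum>i\<in>I - {i0}. x i * a i j / a i0 j * a i0 j')"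
        unfolding a'_def by (simp add: right_diff_distrib sum_subtractf mult.assoc)
      also have "(\<Sum>i\<in>I - {i0}. x i * a i j / a i0 j * a i0 j') = s / a i0 j * a i0 j'"
        by (simp add: s_def sum_distrib_right sum_divide_distrib)
      finally show ?thesis by (simp add: sum_y)
    qed
    moreover have "y i1 \<noteq> 0" using i1 by (auto simp: y_def)
    ultimately show ?thesis using i1 by (intro exI[of _ y]) blast
  qed
qed

text \<open>Yields an algebraic relation for \<open>v\<close> modulo \<open>F\<close> whose cofactor
  \<open>w\<close> is supported in \<open>rK\<close>, so that it homogenises into the
  \<open>r\<close>-th power of the ideal. The \<open>r + 2\<close> powers of \<open>v\<close> and
  the shifts of \<open>F\<close> by exponents in \<open>rK\<close> all have support in
  \<open>(r + 1)K\<close>; at a step of small growth there are more of them than exponents, so they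
  are dependent.\<close>

lemma relation_modulo:
  fixes F v :: "'k::field poly"
  assumes K: "K \<subseteq> {..N}" "0 \<in> K" and F: "F \<in> polys_on K" "F \<noteq> 0" and v: "v \<in> polys_on K"
  obtains r w \<chi> where "w \<in> polys_on (sumset_pow K r)" "\<exists>i\<le>Suc r. \<chi> i \<noteq> 0"
    "(\<Sum>i\<le>Suc r. Polynomial.smult (\<chi> i) (v ^ i)) = F * w"
proof -
  obtain r where r: "r \<ge> N" "card (sumset_pow K (Suc r)) \<le> card (sumset_pow K r) + N"
    using sumset_pow_growth[OF K] by blast
  let ?S = "sumset_pow K r" and ?U = "sumset_pow K (Suc r)"
  \<comment> \<open>The left summand indexes the unknown coefficients \<open>\<chi>\<close>, the
    right one those of \<open>w\<close>; each exponent in \<open>?U\<close> contributes one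
    equation.\<close>
  define a where "a = case_sum (\<lambda>i. Polynomial.coeff (v ^ i))
    (\<lambda>e. Polynomial.coeff (- F * Polynomial.monom 1 e))"
  have fin: "finite ?S" "finite ?U" using finite_sumset_pow[OF K(1)] by blast+
  have "card ?U < card ({..Suc r} <+> ?S)" using r fin by (simp add: card_Plus)
  then have "\<exists>x. (\<exists>i\<in>{..Suc r} <+> ?S. x i \<noteq> 0) \<and>
      (\<forall>j\<in>?U. (\<Sum>i\<in>{..Suc r} <+> ?S. x i * a i j) = 0)"
    by (intro homogeneous_system) (use fin in auto)
  then obtain x where x: "\<exists>i\<in>{..Suc r} <+> ?S. x i \<noteq> 0"
      "\<And>j. j \<in> ?U \<Longrightarrow> (\<Sum>i\<in>{..Suc r} <+> ?S. x i * a i j) = 0"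
    by metis
  define \<chi> where "\<chi> i = x (Inl i)" for i
  define w where "w = (\<Sum>e\<in>?S. Polynomial.monom (x (Inr e)) e)"
  have w: "w \<in> polys_on ?S" unfolding w_def by (rule polys_on_sum) simp
  let ?V = "\<Sum>i\<le>Suc r. Polynomial.smult (\<chi> i) (v ^ i)"
  have w_eq: "w = (\<Sum>e\<in>?S. Polynomial.smult (x (Inr e)) (Polynomial.monom 1 e))"
    by (simp add: w_def smult_monom)
  have co: "Polynomial.coeff (?V - F * w) j = (\<Sum>i\<in>{..Suc r} <+> ?S. x i * a i j)" for j
    unfolding w_eq using fin
    by (simp add: sum.Plus a_def \<chi>_def coeff_sum sum_distrib_left sum_negf del: sum.atMost_Suc)
  have "v ^ i \<in> polys_on ?U" if "i \<le> Suc r" for i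
    using polys_on_mono[OF sumset_pow_mono[OF K(2) that] polys_on_power[OF v]] .
  then have "?V \<in> polys_on ?U" by (intro polys_on_sum polys_on_simps(4)) auto
  moreover have "F * w \<in> polys_on ?U"
    using polys_on_mult[of F K "Suc 0" w r] F w unfolding sumset_pow_1 by simp
  ultimately have "?V - F * w \<in> polys_on ?U" by (rule polys_on_simps(3))
  then have "Polynomial.coeff (?V - F * w) j \<noteq> 0 \<Longrightarrow> j \<in> ?U" for j
    unfolding polys_on_def by blast
  then have "Polynomial.coeff (?V - F * w) j = 0" for j
    using x(2)[of j] unfolding co by blast
  then have "?V - F * w = 0" unfolding poly_eq_iff by simp
  then have rel: "?V = F * w" by simp
  \<comment> \<open>If all \<open>\<chi> i\<close> vanished, \<open>F * w = 0\<close> would force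
    \<open>w = 0\<close>, and the solution of the system would be trivial.\<close>
  have "\<exists>i\<le>Suc r. \<chi> i \<noteq> 0"
  proof (rule ccontr)
    assume neg: "\<not> ?thesis"
    then have "?V = 0" by (intro sum.neutral) auto
    then have "w = 0" using rel F by simp
    have "x (Inr e) = 0" if "e \<in> ?S" for e
    proof -
      have "Polynomial.coeff w e = (\<Sum>e'\<in>?S. if e' = e then x (Inr e) else 0)"
        unfolding w_def coeff_sum by (rule sum.cong) (auto simp: coeff_monom)
      then show ?thesis using that fin \<open>w = 0\<close> by simp
    qed
    then show False using x(1) neg by (auto simp: \<chi>_def)
  qed
  then show thesis using that w rel by blast
qed

section \<open>Exponents with nonvanishing multinomial coefficients\<close>

text \<open>The numbers congruent to sums over \<open>K\<close> are closed under addition and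
  congruence modulo \<open>N\<close>. Their least positive member divides all of them by division
  with remainder, in particular every element of \<open>K\<close>, so it is 1.\<close>

lemma sum_list_residue:
  fixes K :: "nat set"
  assumes "Gcd K = 1" "N \<in> K" "0 < N"
  shows "\<exists>ks. set ks \<subseteq> K \<and> [sum_list ks = x] (mod N)"
proof -
  define S where "S = {e. \<exists>ks. set ks \<subseteq> K \<and> [sum_list ks = e] (mod N)}"
  have S_add: "a + b \<in> S" if ab: "a \<in> S" "b \<in> S" for a b
  proof -
    obtain ks ls where "set ks \<subseteq> K" "[sum_list ks = a] (mod N)" "set ls \<subseteq> K" "[sum_list ls = b] (mod N)"
      using ab unfolding S_def by blast
    then have "set (ks @ ls) \<subseteq> K \<and> [sum_list (ks @ ls) = a + b] (mod N)" by (simp add: cong_add)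
    then show ?thesis unfolding S_def by blast
  qed
  have "set [] \<subseteq> K \<and> [sum_list [] = 0] (mod N)" by simp
  then have S_0: "0 \<in> S" unfolding S_def by blast
  have S_mult: "n * a \<in> S" if "a \<in> S" for n a
    by (induction n) (use S_0 S_add that in auto)
  have S_cong: "b \<in> S" if "a \<in> S" "[a = b] (mod N)" for a b
    using that cong_trans unfolding S_def by blast
  have S_K: "k \<in> S" if "k \<in> K" for k
  proof -
    have "set [k] \<subseteq> K \<and> [sum_list [k] = k] (mod N)" using that by simp
    then show ?thesis unfolding S_def by blast
  qed
  define d where "d = (LEAST d. 0 < d \<and> d \<in> S)"
  have d: "0 < d \<and> d \<in> S" unfolding d_def
    by (rule LeastI[of "\<lambda>d. 0 < d \<and> d \<in> S" N]) (use assms S_K in auto)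
  have "d dvd e" if "e \<in> S" for e
  proof -
    define f where "f = e div d * d"
    have "f \<in> S" unfolding f_def using d by (intro S_mult) simp
    \<comment> \<open>Adding \<open>(N - 1) * f\<close> replaces subtracting \<open>f\<close> modulo
      \<open>N\<close>, without leaving the natural numbers.\<close>
    then have "e + (N - 1) * f \<in> S" using S_add that S_mult by simp
    moreover have "e + (N - 1) * f = e mod d + f * N"
      using assms(3) div_mult_mod_eq[of e d] unfolding f_def[symmetric]
      by (cases N) (auto simp: mult.commute)
    ultimately have "e mod d \<in> S" by (intro S_cong[of "e + (N - 1) * f" "e mod d"]) (auto simp: cong_def)
    moreover have "e mod d < d" using d by simp
    ultimately have "e mod d = 0" using not_less_Least[of "e mod d" "\<lambda>d. 0 < d \<and> d \<in> S"] d_def by auto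
    then show ?thesis by auto
  qed
  then have "d dvd Gcd K" using S_K by (intro Gcd_greatest) auto
  then have "1 \<in> S" using assms(1) d by simp
  then have "x * 1 \<in> S" by (rule S_mult)
  then show ?thesis by (simp add: S_def)
qed

text \<open>Powers of \<open>p\<close> are eventually periodic modulo \<open>N\<close>; an exponent
  that is a multiple of the period and lies beyond the preperiod gives an idempotent. If
  \<open>p\<close> and \<open>N\<close> share a prime factor, no positive power is congruent to 1,
  and the idempotent takes its place.\<close>

lemma idempotent_power_mod:
  fixes p N :: nat
  assumes "0 < N"
  obtains w where "0 < w" "[p ^ w * p ^ w = p ^ w] (mod N)"
proof -
  have "\<not> inj (\<lambda>i. p ^ i mod N)"
  proof
    assume "inj (\<lambda>i. p ^ i mod N)"
    then have "infinite (range (\<lambda>i. p ^ i mod N))" by (simp add: finite_image_iff)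
    moreover have "range (\<lambda>i. p ^ i mod N) \<subseteq> {..<N}" using assms by auto
    ultimately show False using finite_subset by blast
  qed
  then obtain i j where ij: "i < j" "[p ^ i = p ^ j] (mod N)"
    unfolding inj_def cong_def by (metis linorder_neqE_nat)
  define d where "d = j - i"
  have per: "[p ^ (a + d) = p ^ a] (mod N)" if "i \<le> a" for a
  proof -
    have "[p ^ (a - i) * p ^ j = p ^ (a - i) * p ^ i] (mod N)"
      using ij(2) by (intro cong_scalar_left) (rule cong_sym)
    moreover have "a - i + j = a + d" "a - i + i = a" using that ij by (auto simp: d_def)
    ultimately show ?thesis unfolding power_add[symmetric] by metis
  qed
  have pers: "[p ^ (a + d * n) = p ^ a] (mod N)" if "i \<le> a" for a n
  proof (induction n)
    case (Suc n)
    have "[p ^ (a + d * n + d) = p ^ (a + d * n)] (mod N)" using that by (intro per) simp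
    then show ?case using Suc cong_trans by (simp add: ac_simps) blast
  qed simp
  have d0: "0 < d" using ij by (simp add: d_def)
  then have "i \<le> d * (i + 1)"
    by (metis Suc_eq_plus1 le_SucI le_add1 le_trans mult_le_mono2 nat_mult_1 One_nat_def Suc_leI mult.commute)
  from pers[OF this, of "i + 1"] have "[p ^ (d * (i + 1)) * p ^ (d * (i + 1)) = p ^ (d * (i + 1))] (mod N)"
    by (simp add: power_add)
  moreover have "0 < d * (i + 1)" using d0 by simp
  ultimately show thesis using that by blast
qed

text \<open>The product of the binomial coefficients required to be units modulo \<open>p\<close> is the
  multinomial coefficient of the second components.\<close>

primrec sep_list :: "nat \<Rightarrow> (nat \<times> nat) list \<Rightarrow> bool" where
  "sep_list p [] \<longleftrightarrow> True"
| "sep_list p (x # xs) \<longleftrightarrow>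
    \<not> p dvd ((snd x + sum_list (map snd xs)) choose snd x) \<and> sep_list p xs"

text \<open>A case of Lucas' theorem. By the Frobenius map \<open>(1 + X) ^ l\<close> is 1 modulo
  \<open>X ^ (p ^ w)\<close>, so the coefficient of \<open>X ^ m\<close> in
  \<open>(1 + X) ^ (m + l)\<close> is that in \<open>(1 + X) ^ m\<close>, which is 1.\<close>

lemma binomial_not_dvd_CHAR:
  assumes p: "p = CHAR('k::field)" "prime p" and m: "m < p ^ w" and l: "p ^ w dvd l"
  shows "\<not> p dvd ((m + l) choose m)"
proof -
  let ?X = "[:0, 1:] :: 'k poly"
  obtain r where r: "l = p ^ w * r" using l by blast
  have one: "[:1, 1:] = 1 + ?X" by (simp add: one_pCons)
  have "[:1, 1:] ^ (p ^ w) = 1 + ?X ^ (p ^ w)"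
    unfolding one using p by (subst freshmans_dream') auto
  then have "[:1, 1:] ^ l = (1 + ?X ^ (p ^ w)) ^ r" by (simp add: r power_mult)
  moreover have "?X ^ (p ^ w) dvd (1 + ?X ^ (p ^ w)) ^ r - 1"
    using power_diff_1_eq[of "1 + ?X ^ (p ^ w)" r] by simp
  ultimately obtain z where "[:1, 1:] ^ l - 1 = ?X ^ (p ^ w) * z" by (metis dvdE)
  then have z: "[:1, 1:] ^ l = 1 + ?X ^ (p ^ w) * z" by (simp add: algebra_simps)
  have "[:1, 1:] ^ (m + l) = [:1, 1:] ^ m + ?X ^ (p ^ w) * (z * [:1, 1:] ^ m)"
    unfolding power_add z by (simp add: algebra_simps)
  then have "Polynomial.coeff ([:1, 1 :: 'k:] ^ (m + l)) m = Polynomial.coeff ([:1, 1:] ^ m) m"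
    using m by (simp add: monom_altdef[symmetric, of 1, simplified] coeff_monom_mult)
  then have "of_nat ((m + l) choose m) = (1 :: 'k)" by (simp add: coeff_linear_poly_power)
  then show ?thesis using p(1) by (metis of_nat_eq_0_iff_char_dvd zero_neq_one)
qed

text \<open>In characteristic 0 all multiplicities can be 1. In characteristic \<open>p\<close> let
  \<open>q = p ^ w\<close> be idempotent modulo \<open>N\<close>. The multiplicities
  \<open>u < q\<close>, \<open>q\<close>, \<open>q ^ 2\<close>, ... occupy separate digits in base
  \<open>q\<close>, so the binomial coefficients are units, while modulo \<open>N\<close> all the
  positive powers equal \<open>q\<close>. A first pair \<open>(k, u)\<close> with \<open>k\<close>
  prime to \<open>p\<close> meets the target modulo \<open>q\<close>; the remaining multiple of
  \<open>q\<close> is met by \<open>q\<close> times a sum over \<open>K\<close>.\<close>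

lemma exists_sep_list:
  assumes p: "p = CHAR('k::field)"
    and K: "Gcd K = 1" "N \<in> K" "0 < N"
  shows "\<exists>xs. fst ` set xs \<subseteq> K \<and> sep_list p xs \<and> [(\<Sum>(k, m)\<leftarrow>xs. k * m) = \<kappa>] (mod N)"
proof (cases "p = 0")
  case True
  have sep: "sep_list 0 xs" for xs by (induction xs) auto
  obtain ks where ks: "set ks \<subseteq> K" "[sum_list ks = \<kappa>] (mod N)" using sum_list_residue[OF K] by blast
  have "(\<Sum>(k, m)\<leftarrow>map (\<lambda>k. (k, 1)) ks. k * m) = sum_list ks" by (induction ks) auto
  then show ?thesis using sep ks True by (intro exI[of _ "map (\<lambda>k. (k, 1)) ks"]) (auto simp: image_image)
next
  case False
  then have pr: "prime p" using p prime_CHAR_semidom[where 'a = 'k] by simp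
  obtain w where w: "0 < w" and idem: "[p ^ w * p ^ w = p ^ w] (mod N)"
    using idempotent_power_mod[OF K(3)] by blast
  define q where "q = p ^ w"
  have q_pow: "q ^ i = p ^ (w * i)" for i by (simp add: q_def power_mult)
  have q1: "1 < q" using w prime_gt_1_nat[OF pr] unfolding q_def by (rule one_less_power[rotated])
  have idem': "[q ^ Suc i = q] (mod N)" for i
  proof (induction i)
    case (Suc i)
    then have "[q * q ^ Suc i = q * q] (mod N)" by (rule cong_scalar_left)
    then show ?case using idem unfolding q_def[symmetric] by (simp add: cong_trans)
  qed simp
  have "\<not> p dvd Gcd K" using K(1) prime_gt_1_nat[OF pr] by auto
  then obtain k where k: "k \<in> K" "\<not> p dvd k" by (meson Gcd_greatest)
  have "coprime k q" using k(2) pr unfolding q_def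
    by (metis coprime_commute coprime_power_right_iff prime_imp_coprime w)
  then obtain k' where k': "[k * k' = 1] (mod q)" using cong_solve_coprime_nat by auto
  define u where "u = k' * \<kappa> mod q"
  have u: "u < q" using q1 by (simp add: u_def)
  have "[k * u = k * (k' * \<kappa>)] (mod q)" unfolding u_def by (intro cong_scalar_left) (simp add: cong_def)
  also have "[k * (k' * \<kappa>) = \<kappa>] (mod q)" using cong_scalar_right[OF k', of \<kappa>] by (simp add: mult.assoc)
  finally have ku: "[k * u = \<kappa>] (mod q)" .
  \<comment> \<open>The added multiple of \<open>N * q\<close> changes the target neither modulo
    \<open>N\<close> nor modulo \<open>q\<close>, and makes it at least \<open>k * u\<close>, so
    that the difference is a natural number.\<close>
  define \<kappa>' where "\<kappa>' = \<kappa> + N * q * k"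
  have "[\<kappa>' = \<kappa>] (mod q)" by (simp add: \<kappa>'_def cong_def mult.assoc mult.left_commute[of _ q])
  moreover have le: "k * u \<le> \<kappa>'"
  proof -
    have "k * u \<le> k * q" using u by simp
    also have "\<dots> \<le> N * (k * q)" using K(3) by simp
    finally have "k * u \<le> N * (k * q)" .
    moreover have "\<kappa>' = \<kappa> + N * (k * q)" unfolding \<kappa>'_def by (simp only: mult_ac)
    ultimately show ?thesis by linarith
  qed
  ultimately have "q dvd \<kappa>' - k * u" using ku cong_trans cong_sym by (metis cong_altdef_nat)
  then obtain y where y: "\<kappa>' = k * u + q * y" using le by (metis dvdE le_add_diff_inverse)
  obtain ks where ks: "set ks \<subseteq> K" "[sum_list ks = y] (mod N)" using sum_list_residue[OF K] by blast
  define tail where "tail ks i = zip ks (map (\<lambda>j. q ^ j) [i..<i + length ks])" for ks :: "nat list" and i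
  have tail_simps: "tail [] i = []" "tail (a # as) i = (a, q ^ i) # tail as (Suc i)" for a as i
    unfolding tail_def using upt_rec[of i "i + length (a # as)"] by auto
  \<comment> \<open>The powers start at \<open>Suc i\<close> because the congruence with
    \<open>q\<close> concerns positive exponents. The divisibility clause carries the induction: the
    later multiplicities must be divisible by a power of \<open>q\<close> exceeding the current
    one.\<close>
  have tail: "fst ` set (tail ks (Suc i)) \<subseteq> set ks \<and> sep_list p (tail ks (Suc i)) \<and>
      q ^ Suc i dvd sum_list (map snd (tail ks (Suc i))) \<and>
      [(\<Sum>(k, m)\<leftarrow>tail ks (Suc i). k * m) = q * sum_list ks] (mod N)" for ks i
  proof (induction ks arbitrary: i)
    case Nil
    then show ?case by (simp add: tail_simps)
  next
    case (Cons a as)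
    let ?t = "tail as (Suc (Suc i))"
    have IH: "fst ` set ?t \<subseteq> set as" "sep_list p ?t" "q ^ Suc (Suc i) dvd sum_list (map snd ?t)"
      "[(\<Sum>(k, m)\<leftarrow>?t. k * m) = q * sum_list as] (mod N)" using Cons[of "Suc i"] by blast+
    have "\<not> p dvd ((q ^ Suc i + sum_list (map snd ?t)) choose q ^ Suc i)"
    proof (rule binomial_not_dvd_CHAR[OF p pr])
      have "q ^ Suc i < q ^ Suc (Suc i)" using q1 by (intro power_strict_increasing) auto
      then show "q ^ Suc i < p ^ (w * Suc (Suc i))" by (simp only: q_pow)
      show "p ^ (w * Suc (Suc i)) dvd sum_list (map snd ?t)" using IH(3) by (simp only: q_pow)
    qed
    moreover have "q ^ Suc i dvd sum_list (map snd ?t)"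
      using IH(3) dvd_trans le_imp_power_dvd by (metis lessI less_imp_le)
    moreover have "[a * q ^ Suc i + (\<Sum>(k, m)\<leftarrow>?t. k * m) = a * q + q * sum_list as] (mod N)"
      by (intro cong_add IH cong_scalar_left idem')
    ultimately show ?case using IH unfolding tail_simps by (auto simp: algebra_simps)
  qed
  let ?xs = "(k, u) # tail ks (Suc 0)"
  have t: "fst ` set (tail ks (Suc 0)) \<subseteq> set ks" "sep_list p (tail ks (Suc 0))"
    "q dvd sum_list (map snd (tail ks (Suc 0)))"
    "[(\<Sum>(k, m)\<leftarrow>tail ks (Suc 0). k * m) = q * sum_list ks] (mod N)"
    using tail[of ks 0] by simp_all
  have "\<not> p dvd ((u + sum_list (map snd (tail ks (Suc 0)))) choose u)"
    using t(3) u p pr unfolding q_def by (intro binomial_not_dvd_CHAR[where 'k = 'k]) auto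
  moreover have "[k * u + (\<Sum>(k, m)\<leftarrow>tail ks (Suc 0). k * m) = \<kappa>] (mod N)"
  proof -
    have "[k * u + (\<Sum>(k, m)\<leftarrow>tail ks (Suc 0). k * m) = k * u + q * sum_list ks] (mod N)"
      using t(4) by (intro cong_add) auto
    also have "[k * u + q * sum_list ks = k * u + q * y] (mod N)"
      by (intro cong_add cong_scalar_left ks) simp
    also have "[k * u + q * y = \<kappa>] (mod N)"
      unfolding y[symmetric] by (simp add: \<kappa>'_def cong_def mult.assoc)
    finally show ?thesis .
  qed
  ultimately show ?thesis using t ks(1) k(1) by (intro exI[of _ ?xs]) auto
qed

section \<open>Vanishing of a polynomial in all two-generated ideals\<close>

definition linear_functional :: "('k::field poly \<Rightarrow> 'k) \<Rightarrow> bool" where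
  "linear_functional \<tau> \<longleftrightarrow>
    (\<forall>p q. \<tau> (p + q) = \<tau> p + \<tau> q) \<and> (\<forall>c p. \<tau> (Polynomial.smult c p) = c * \<tau> p)"

lemma linear_functional_add: "linear_functional \<tau> \<Longrightarrow> \<tau> (p + q) = \<tau> p + \<tau> q"
  and linear_functional_smult: "linear_functional \<tau> \<Longrightarrow> \<tau> (Polynomial.smult c p) = c * \<tau> p"
  by (auto simp: linear_functional_def)

lemma linear_functional_0: "linear_functional \<tau> \<Longrightarrow> \<tau> 0 = 0"
  using linear_functional_smult[of \<tau> 0 0] by simp

lemma linear_functional_sum: "linear_functional \<tau> \<Longrightarrow> \<tau> (sum f A) = (\<Sum>i\<in>A. \<tau> (f i))"
  by (induction A rule: infinite_finite_induct)
    (auto simp: linear_functional_0 linear_functional_add)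

lemma poly_eq_0_infinite_roots:
  fixes p :: "'k::field poly"
  assumes "infinite A" "\<And>x. x \<in> A \<Longrightarrow> poly p x = 0"
  shows "p = 0"
  using assms poly_roots_finite[of p] finite_subset[of A "{x. poly p x = 0}"] by blast

text \<open>With \<open>v\<close> replaced by \<open>v + t Y^k\<close> the vanishing expression is a
  polynomial in \<open>t\<close> that is zero on an infinite field. Its coefficient of
  \<open>t ^ m\<close> is the desired value times a binomial coefficient that is nonzero in
  \<open>'k\<close>.\<close>

lemma polarise:
  fixes \<tau> :: "'k::field poly \<Rightarrow> 'k"
  assumes inf: "infinite (UNIV :: 'k set)" and lin: "linear_functional \<tau>"
    and van: "\<And>v. v \<in> polys_on K \<Longrightarrow> \<tau> (u * v ^ (m + l)) = 0"
    and k: "k \<in> K" and bin: "\<not> CHAR('k) dvd ((m + l) choose m)"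
    and v: "v \<in> polys_on K"
  shows "\<tau> (u * Polynomial.monom 1 (k * m) * v ^ l) = 0"
proof -
  define a where "a i = of_nat ((m + l) choose i) *
    \<tau> (u * Polynomial.monom 1 (k * i) * v ^ (m + l - i))" for i
  define P where "P = (\<Sum>i\<le>m + l. Polynomial.monom (a i) i)"
  have "poly P t = 0" for t
  proof -
    have "0 = \<tau> (u * (Polynomial.monom t k + v) ^ (m + l))"
      using k v by (intro van[symmetric]) simp
    also have "u * (Polynomial.monom t k + v) ^ (m + l) =
      (\<Sum>i\<le>m + l. Polynomial.smult (of_nat ((m + l) choose i) * t ^ i)
        (u * Polynomial.monom 1 (k * i) * v ^ (m + l - i)))"
    proof -
      have "Polynomial.monom t k ^ i = Polynomial.smult (t ^ i) (Polynomial.monom 1 (k * i))" for i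
        by (simp add: monom_power smult_monom mult.commute)
      moreover have "of_nat j * p = Polynomial.smult (of_nat j) p" for j and p :: "'k poly"
        by (simp add: of_nat_poly)
      ultimately show ?thesis
        unfolding binomial_ring sum_distrib_left by (intro sum.cong) (simp_all add: mult_ac)
    qed
    also have "\<tau> \<dots> = poly P t"
      unfolding linear_functional_sum[OF lin] linear_functional_smult[OF lin]
      by (simp add: P_def poly_sum poly_monom a_def mult_ac)
    finally show ?thesis ..
  qed
  then have "P = 0" by (intro poly_eq_0_infinite_roots[OF inf])
  moreover have "Polynomial.coeff P m = a m"
    unfolding P_def coeff_sum by (simp add: coeff_monom)
  ultimately have "a m = 0" by simp
  then show ?thesis using bin by (simp add: a_def of_nat_eq_0_iff_char_dvd)
qed

text \<open>Each pair \<open>(k, m)\<close> trades \<open>m\<close> factors \<open>v\<close> for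
  \<open>Y ^ (k * m)\<close>; the binomial coefficients met on the way are those controlled by
  \<open>sep_list\<close>.\<close>

lemma polarise_list:
  fixes \<tau> :: "'k::field poly \<Rightarrow> 'k"
  assumes inf: "infinite (UNIV :: 'k set)" and lin: "linear_functional \<tau>"
    and "\<And>v. v \<in> polys_on K \<Longrightarrow> \<tau> (u * v ^ sum_list (map snd xs)) = 0"
    and "fst ` set xs \<subseteq> K" "sep_list CHAR('k) xs"
  shows "\<tau> (u * Polynomial.monom 1 (\<Sum>(k, m)\<leftarrow>xs. k * m)) = 0"
  using assms(3-)
proof (induction xs arbitrary: u)
  case Nil
  from Nil(1)[of 0] show ?case by simp
next
  case (Cons x xs)
  obtain k m where x: "x = (k, m)" by (cases x)
  have "\<tau> (u * Polynomial.monom 1 (k * m) * v ^ sum_list (map snd xs)) = 0" if "v \<in> polys_on K" for v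
    using Cons.prems x that by (intro polarise[OF inf lin, where K = K]) auto
  then have "\<tau> (u * Polynomial.monom 1 (k * m) * Polynomial.monom 1 (\<Sum>(k, m)\<leftarrow>xs. k * m)) = 0"
    using Cons.prems by (intro Cons.IH) auto
  then show ?case by (simp add: x mult_monom mult.assoc)
qed

text \<open>If \<open>\<chi>(v) = 0\<close> modulo \<open>F\<close>, then \<open>1 - \<sigma> v\<close> is invertible modulo \<open>F\<close>, up to the value at \<open>\<sigma>\<close>
  of the reversed polynomial of \<open>\<chi>\<close>.\<close>

definition resolvent :: "nat \<Rightarrow> (nat \<Rightarrow> 'k::field) \<Rightarrow> 'k poly \<Rightarrow> 'k \<Rightarrow> 'k poly" where
  "resolvent D \<chi> v \<sigma> =
    (\<Sum>i\<le>D. \<Sum>j<i. Polynomial.smult (\<chi> i * \<sigma> ^ (D - i + j)) (v ^ j))"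

lemma smult_sum_right: "Polynomial.smult c (sum f A) = (\<Sum>i\<in>A. Polynomial.smult c (f i))"
  by (induction A rule: infinite_finite_induct) (auto simp: smult_add_right)

text \<open>The product of \<open>1 - \<sigma> v\<close> with each geometric sum telescopes to
  \<open>1 - (\<sigma> v) ^ i\<close>. The subtracted powers add up to \<open>\<sigma> ^ D\<close>
  times \<open>\<chi>(v)\<close>, a multiple of \<open>F\<close>.\<close>

lemma resolvent_identity:
  fixes F v w :: "'k::field poly"
  assumes "(\<Sum>i\<le>D. Polynomial.smult (\<chi> i) (v ^ i)) = F * w"
  shows "[:\<Sum>i\<le>D. \<chi> i * \<sigma> ^ (D - i):] =
    F * Polynomial.smult (\<sigma> ^ D) w + (1 - Polynomial.smult \<sigma> v) * resolvent D \<chi> v \<sigma>"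
proof -
  have "F * Polynomial.smult (\<sigma> ^ D) w = (\<Sum>i\<le>D. Polynomial.smult (\<chi> i * \<sigma> ^ D) (v ^ i))"
    unfolding mult_smult_right assms[symmetric] smult_sum_right smult_smult by (simp add: mult.commute)
  also have "\<dots> = (\<Sum>i\<le>D. [:\<chi> i * \<sigma> ^ (D - i):] * Polynomial.smult \<sigma> v ^ i)"
  proof (rule sum.cong)
    fix i assume "i \<in> {..D}"
    then have "\<sigma> ^ D = \<sigma> ^ i * \<sigma> ^ (D - i)" by (simp flip: power_add)
    then show "Polynomial.smult (\<chi> i * \<sigma> ^ D) (v ^ i) =
        [:\<chi> i * \<sigma> ^ (D - i):] * Polynomial.smult \<sigma> v ^ i"
      by (simp add: smult_power mult_ac)
  qed simp
  finally have 1: "F * Polynomial.smult (\<sigma> ^ D) w = \<dots>" .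
  have "resolvent D \<chi> v \<sigma> = (\<Sum>i\<le>D. [:\<chi> i * \<sigma> ^ (D - i):] * (\<Sum>j<i. Polynomial.smult \<sigma> v ^ j))"
    unfolding resolvent_def sum_distrib_left
    by (intro sum.cong) (auto simp: smult_power power_add mult_ac simp del: add_diff_assoc2 diff_add_assoc2 Nat.add_diff_assoc2)
  then have "(1 - Polynomial.smult \<sigma> v) * resolvent D \<chi> v \<sigma> =
    (\<Sum>i\<le>D. [:\<chi> i * \<sigma> ^ (D - i):] * ((1 - Polynomial.smult \<sigma> v) * (\<Sum>j<i. Polynomial.smult \<sigma> v ^ j)))"
    by (simp add: sum_distrib_left mult.left_commute)
  also have "\<dots> = (\<Sum>i\<le>D. [:\<chi> i * \<sigma> ^ (D - i):] * (1 - Polynomial.smult \<sigma> v ^ i))"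
    unfolding one_diff_power_eq ..
  also have "\<dots> = (\<Sum>i\<le>D. [:\<chi> i * \<sigma> ^ (D - i):]) -
      (\<Sum>i\<le>D. [:\<chi> i * \<sigma> ^ (D - i):] * Polynomial.smult \<sigma> v ^ i)"
    unfolding right_diff_distrib mult_1_right sum_subtractf ..
  finally show ?thesis unfolding 1 by (simp add: sum_to_poly)
qed

text \<open>The value of \<open>\<tau>\<close> on \<open>H\<close> times the resolvent is a
  polynomial in \<open>\<sigma>\<close> with infinitely many zeros, so its coefficients vanish; by
  induction these give \<open>a l = 0\<close> below the top index \<open>t\<close> of
  \<open>\<chi>\<close>. From \<open>t\<close> on, the relation \<open>\<chi>(v) = 0\<close> modulo
  \<open>F\<close> is a linear recurrence for \<open>a\<close>.\<close>

lemma functional_power_eq_0: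
  fixes \<tau> :: "'k::field poly \<Rightarrow> 'k"
  assumes lin: "linear_functional \<tau>" and kill: "\<And>p. \<tau> (F * p) = 0"
    and rel: "(\<Sum>i\<le>D. Polynomial.smult (\<chi> i) (v ^ i)) = F * w" and nz: "\<exists>i\<le>D. \<chi> i \<noteq> 0"
    and inf: "infinite A" and van: "\<And>\<sigma>. \<sigma> \<in> A \<Longrightarrow> \<tau> (H * resolvent D \<chi> v \<sigma>) = 0"
  shows "\<tau> (H * v ^ l) = 0"
proof -
  define a where "a j = \<tau> (H * v ^ j)" for j
  define P where "P = (\<Sum>i\<le>D. \<Sum>j<i. Polynomial.monom (\<chi> i * a j) (D - i + j))"
  have "poly P \<sigma> = \<tau> (H * resolvent D \<chi> v \<sigma>)" for \<sigma>
    unfolding resolvent_def sum_distrib_left linear_functional_sum[OF lin] mult_smult_right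
      linear_functional_smult[OF lin] P_def poly_sum poly_monom a_def
    by (intro sum.cong) (auto simp: mult_ac)
  then have P: "P = 0" using poly_eq_0_infinite_roots[OF inf, of P] van by simp
  \<comment> \<open>The relation only guarantees some nonzero \<open>\<chi> i\<close>, so its true
    degree \<open>t\<close> may be smaller than \<open>D\<close>.\<close>
  define t where "t = Max {i. i \<le> D \<and> \<chi> i \<noteq> 0}"
  have fin: "finite {i. i \<le> D \<and> \<chi> i \<noteq> 0}" by simp
  have t: "t \<le> D" "\<chi> t \<noteq> 0" using Max_in[OF fin] nz unfolding t_def by auto
  have t_max: "\<chi> i = 0" if "t < i" "i \<le> D" for i
  proof (rule ccontr)
    assume "\<chi> i \<noteq> 0"
    then have "i \<le> t" unfolding t_def using that by (intro Max_ge[OF fin]) simp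
    then show False using that by simp
  qed
  have "a l = 0"
  proof (induction l rule: less_induct)
    case (less l)
    show ?case
    proof (cases "l < t")
      case True
      \<comment> \<open>In this coefficient a term with \<open>i < t\<close> has
        \<open>j < l\<close> and vanishes by induction, and a term with \<open>i > t\<close> has
        \<open>\<chi> i = 0\<close>; only \<open>\<chi> t * a l\<close> survives.\<close>
      have "0 = Polynomial.coeff P (D - t + l)" by (simp add: P)
      also have "\<dots> = (\<Sum>i\<le>D. \<Sum>j<i. if D - i + j = D - t + l then \<chi> i * a j else 0)"
        by (simp add: P_def coeff_sum coeff_monom)
      also have "\<dots> = (\<Sum>i\<le>D. \<Sum>j<i. if j = l then (if i = t then \<chi> t * a l else 0) else 0)"
      proof (intro sum.cong refl)
        fix i j assume ij: "i \<in> {..D}" "j \<in> {..<i}"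
        show "(if D - i + j = D - t + l then \<chi> i * a j else 0) =
          (if j = l then (if i = t then \<chi> t * a l else 0) else 0)"
        proof (cases i t rule: linorder_cases)
          case less
          then have "D - i + j = D - t + l \<Longrightarrow> j < l" using ij t by auto
          then show ?thesis using less.IH less by auto
        next
          case equal
          then show ?thesis by auto
        next
          case greater
          then show ?thesis using t_max[of i] ij by auto
        qed
      qed
      also have "\<dots> = (\<Sum>i\<le>D. if i = t then \<chi> t * a l else 0)"
        using True by (intro sum.cong) auto
      also have "\<dots> = \<chi> t * a l" using t by simp
      finally show ?thesis using t by simp
    next
      case False
      \<comment> \<open>The relation is multiplied by \<open>H * v ^ (l - t)\<close>, so that its
        top term is \<open>\<chi> t * a l\<close> and all others are known to vanish.\<close>
      have "0 = \<tau> (F * (w * (H * v ^ (l - t))))" by (simp only: kill)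
      also have "F * (w * (H * v ^ (l - t))) = (\<Sum>i\<le>D. Polynomial.smult (\<chi> i) (H * v ^ (l - t + i)))"
        unfolding mult.assoc[symmetric] rel[symmetric] sum_distrib_right
        by (intro sum.cong) (auto simp: power_add mult_ac)
      also have "\<tau> \<dots> = (\<Sum>i\<le>D. \<chi> i * a (l - t + i))"
        by (simp add: linear_functional_sum[OF lin] linear_functional_smult[OF lin] a_def)
      also have "\<dots> = (\<Sum>i\<le>D. if i = t then \<chi> t * a l else 0)"
      proof (intro sum.cong refl)
        fix i assume i: "i \<in> {..D}"
        show "\<chi> i * a (l - t + i) = (if i = t then \<chi> t * a l else 0)"
        proof (cases i t rule: linorder_cases)
          case less
          then have "l - t + i < l" using False by auto
          then show ?thesis using less.IH less by auto
        qed (use False t_max i in auto)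
      qed
      also have "\<dots> = \<chi> t * a l" using t by simp
      finally show ?thesis using t by simp
    qed
  qed
  then show ?thesis by (simp add: a_def)
qed

text \<open>For \<open>N > 0\<close> this functional generates the dual of
  \<open>k[Y]/(Y^N - c)\<close> as a module: the residue of that complete intersection.\<close>

definition top_residue :: "nat \<Rightarrow> 'k::field \<Rightarrow> 'k poly \<Rightarrow> 'k" where
  "top_residue N c p = Polynomial.coeff (p mod (Polynomial.monom 1 N - [:c:])) (N - 1)"

lemma linear_top_residue: "linear_functional (top_residue N c)"
  by (simp add: linear_functional_def top_residue_def poly_mod_add_left mod_smult_left)

lemma degree_binomial: "0 < N \<Longrightarrow> Polynomial.degree (Polynomial.monom 1 N - [:c::'k::field:]) = N"
  unfolding diff_conv_add_uminus by (subst degree_add_eq_left) (simp_all add: degree_monom_eq)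

lemma top_residue_monom:
  assumes "0 < N"
  shows "top_residue N c (Polynomial.monom b n) = (if n mod N = N - 1 then b * c ^ (n div N) else 0)"
proof -
  let ?F = "Polynomial.monom 1 N - [:c:]"
  have "?F dvd Polynomial.monom 1 N ^ (n div N) - [:c:] ^ (n div N)"
    unfolding power_diff_sumr2 by simp
  then have "?F dvd Polynomial.monom b (n mod N) * (Polynomial.monom 1 N ^ (n div N) - [:c:] ^ (n div N))"
    by (rule dvd_mult)
  also have "\<dots> = Polynomial.monom b n - Polynomial.monom (b * c ^ (n div N)) (n mod N)"
    by (simp add: right_diff_distrib monom_power mult_monom poly_const_pow smult_monom mult.commute)
  finally have "Polynomial.monom b n mod ?F = Polynomial.monom (b * c ^ (n div N)) (n mod N) mod ?F"
    by (simp add: mod_eq_dvd_iff)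
  also have "\<dots> = Polynomial.monom (b * c ^ (n div N)) (n mod N)"
  proof (rule mod_poly_less)
    have "n mod N < N" using assms by simp
    then show "Polynomial.degree (Polynomial.monom (b * c ^ (n div N)) (n mod N)) < Polynomial.degree ?F"
      unfolding degree_binomial[OF assms] using degree_monom_le le_less_trans by blast
  qed
  finally show ?thesis by (auto simp: top_residue_def coeff_monom)
qed

text \<open>Only powers of \<open>v\<close> below the degree \<open>Suc r\<close> of the relation
  occur, so the support stays in the same sumset \<open>rK\<close> as that of the cofactor
  \<open>w\<close>.\<close>

lemma resolvent_mem:
  assumes K: "0 \<in> K" and v: "v \<in> polys_on K"
  shows "resolvent (Suc r) \<chi> v \<sigma> \<in> polys_on (sumset_pow K r)"
  unfolding resolvent_def
proof (intro polys_on_sum polys_on_simps(4))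
  fix i j assume "i \<in> {..Suc r}" "j \<in> {..<i}"
  then show "v ^ j \<in> polys_on (sumset_pow K r)"
    using polys_on_mono[OF sumset_pow_mono[OF K, of j r] polys_on_power[OF v]] by simp
qed

text \<open>The hypothesis \<open>dec\<close> abstracts membership of a form of degree at most
  \<open>2 * N - 2\<close> in a two-generated reduction. Wherever \<open>s \<sigma>\<close> is
  nonzero, the scaled resolvent \<open>Q'\<close> inverts \<open>1 - \<sigma> v\<close> modulo
  \<open>?F\<close>, so \<open>H * Q'\<close> is congruent to \<open>B\<close>, whose coefficients
  from \<open>N - 1\<close> on are zero. Thus the top residue vanishes for infinitely many
  \<open>\<sigma>\<close>.\<close>

lemma top_residue_power_eq_0:
  fixes H v :: "'k::field poly"
  assumes inf: "infinite (UNIV :: 'k set)"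
    and N: "0 < N" and K: "K \<subseteq> {..N}" "0 \<in> K" "N \<in> K" and v: "v \<in> polys_on K"
    and dec: "\<And>\<sigma> r w Q. w \<in> polys_on (sumset_pow K r) \<Longrightarrow> Q \<in> polys_on (sumset_pow K r) \<Longrightarrow>
      1 = (Polynomial.monom 1 N - [:c:]) * w + (1 - Polynomial.smult \<sigma> v) * Q \<Longrightarrow>
      \<exists>A B. H = (Polynomial.monom 1 N - [:c:]) * A + (1 - Polynomial.smult \<sigma> v) * B \<and>
        (\<forall>i\<ge>N - 1. Polynomial.coeff B i = 0)"
  shows "top_residue N c (H * v ^ l) = 0"
proof -
  let ?F = "Polynomial.monom 1 N - [:c:]"
  have deg: "Polynomial.degree ?F = N" by (rule degree_binomial[OF N])
  then have F0: "?F \<noteq> 0" using N by auto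
  have "Polynomial.monom 1 N \<in> polys_on K" "[:c:] \<in> polys_on K"
    using K by (simp_all flip: monom_0)
  then have F: "?F \<in> polys_on K" by (rule polys_on_simps(3))
  obtain r w \<chi> where w: "w \<in> polys_on (sumset_pow K r)" and nz: "\<exists>i\<le>Suc r. \<chi> i \<noteq> 0"
    and rel: "(\<Sum>i\<le>Suc r. Polynomial.smult (\<chi> i) (v ^ i)) = ?F * w"
    using relation_modulo[OF K(1,2) F F0 v] by metis
  define s where "s \<sigma> = (\<Sum>i\<le>Suc r. \<chi> i * \<sigma> ^ (Suc r - i))" for \<sigma>
  \<comment> \<open>\<open>S\<close> is \<open>\<chi>\<close> reversed; it is nonzero because some
    \<open>\<chi> i\<close> is, so \<open>s\<close> has only finitely many zeros.\<close>
  define S where "S = (\<Sum>i\<le>Suc r. Polynomial.monom (\<chi> i) (Suc r - i))"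
  have s_S: "poly S \<sigma> = s \<sigma>" for \<sigma> unfolding s_def S_def poly_sum poly_monom ..
  obtain i0 where i0: "i0 \<le> Suc r" "\<chi> i0 \<noteq> 0" using nz by blast
  have "Polynomial.coeff S (Suc r - i0) = (\<Sum>i\<le>Suc r. if i = i0 then \<chi> i0 else 0)"
    unfolding S_def coeff_sum using i0 by (intro sum.cong) (auto simp: coeff_monom)
  then have "Polynomial.coeff S (Suc r - i0) \<noteq> 0" using i0 by simp
  then have "S \<noteq> 0" by auto
  then have "finite {\<sigma>. poly S \<sigma> = 0}" by (rule poly_roots_finite)
  then have inf': "infinite {\<sigma>. s \<sigma> \<noteq> 0}"
    using inf finite_Collect_not[of "\<lambda>\<sigma>. s \<sigma> \<noteq> 0"] by (auto simp: s_S)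
  show ?thesis
  proof (rule functional_power_eq_0[OF linear_top_residue _ rel nz inf'])
    show "top_residue N c (?F * p) = 0" for p by (simp add: top_residue_def)
    fix \<sigma> assume "\<sigma> \<in> {\<sigma>. s \<sigma> \<noteq> 0}"
    then have s0: "s \<sigma> \<noteq> 0" by simp
    define Q where "Q = resolvent (Suc r) \<chi> v \<sigma>"
    define w' where "w' = Polynomial.smult (inverse (s \<sigma>) * \<sigma> ^ Suc r) w"
    define Q' where "Q' = Polynomial.smult (inverse (s \<sigma>)) Q"
    have "[:s \<sigma>:] = ?F * Polynomial.smult (\<sigma> ^ Suc r) w + (1 - Polynomial.smult \<sigma> v) * Q"
      unfolding s_def Q_def by (rule resolvent_identity[OF rel])
    then have "Polynomial.smult (inverse (s \<sigma>)) [:s \<sigma>:] = Polynomial.smult (inverse (s \<sigma>)) \<dots>" by simp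
    then have one: "1 = ?F * w' + (1 - Polynomial.smult \<sigma> v) * Q'"
      using s0 unfolding w'_def Q'_def
      by (simp add: smult_add_right mult_smult_right one_pCons del: power_Suc mult_smult_left)
    obtain A B where AB: "H = ?F * A + (1 - Polynomial.smult \<sigma> v) * B"
        "\<And>i. i \<ge> N - 1 \<Longrightarrow> Polynomial.coeff B i = 0"
    proof -
      have "w' \<in> polys_on (sumset_pow K r)" "Q' \<in> polys_on (sumset_pow K r)"
        unfolding w'_def Q'_def Q_def by (intro polys_on_simps(4) w resolvent_mem K v)+
      then show ?thesis using dec[OF _ _ one] that by blast
    qed
    have "Polynomial.degree B < N \<or> B = 0"
    proof -
      have "Polynomial.degree B < N" if "B \<noteq> 0"
      proof -
        have "\<not> N - 1 \<le> Polynomial.degree B"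
          using AB(2)[of "Polynomial.degree B"] that by (metis leading_coeff_0_iff)
        then show ?thesis by simp
      qed
      then show ?thesis by blast
    qed
    then have "B mod ?F = B" using deg by (auto intro: mod_poly_less)
    then have "top_residue N c B = 0" using AB(2)[of "N - 1"] by (simp add: top_residue_def)
    have "H * Q' = ?F * (A * Q') + B * ((1 - Polynomial.smult \<sigma> v) * Q')"
      unfolding AB(1) by (simp add: algebra_simps)
    also have "(1 - Polynomial.smult \<sigma> v) * Q' = 1 - ?F * w'" using one by (simp add: algebra_simps)
    also have "?F * (A * Q') + B * (1 - ?F * w') = ?F * (A * Q' - B * w') + B"
      by (simp add: algebra_simps)
    finally have HQ: "H * Q' = ?F * (A * Q' - B * w') + B" .
    have "top_residue N c (H * Q') = 0"
      unfolding HQ linear_functional_add[OF linear_top_residue]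
      using \<open>top_residue N c B = 0\<close> by (simp add: top_residue_def)
    moreover have "H * Q = Polynomial.smult (s \<sigma>) (H * Q')" using s0 by (simp add: Q'_def)
    ultimately show "top_residue N c (H * resolvent (Suc r) \<chi> v \<sigma>) = 0"
      unfolding Q_def[symmetric] by (simp add: linear_functional_smult[OF linear_top_residue])
  qed
qed

text \<open>To isolate coefficient \<open>j\<close>, an admissible exponent \<open>e\<close> with
  \<open>j + e\<close> congruent to \<open>-1\<close> modulo \<open>N\<close> is chosen. The top
  residue of \<open>H * Y^e\<close> is then a polynomial in \<open>c\<close>, in which coefficient
  \<open>j\<close> of \<open>H\<close> alone stands at \<open>c ^ ((j + e) div N)\<close>. It
  vanishes for all \<open>c\<close> in an infinite field.\<close>

lemma vanishing_criterion:
  fixes H :: "'k::field poly"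
  assumes inf: "infinite (UNIV :: 'k set)"
    and N: "0 < N" and K: "K \<subseteq> {..N}" "0 \<in> K" "N \<in> K" "Gcd K = 1"
    and dec: "\<And>c v \<sigma> r w Q. v \<in> polys_on K \<Longrightarrow> w \<in> polys_on (sumset_pow K r) \<Longrightarrow>
      Q \<in> polys_on (sumset_pow K r) \<Longrightarrow>
      1 = (Polynomial.monom 1 N - [:c:]) * w + (1 - Polynomial.smult \<sigma> v) * Q \<Longrightarrow>
      \<exists>A B. H = (Polynomial.monom 1 N - [:c:]) * A + (1 - Polynomial.smult \<sigma> v) * B \<and>
        (\<forall>i\<ge>N - 1. Polynomial.coeff B i = 0)"
  shows "H = 0"
proof -
  have "Polynomial.coeff H j = 0" for j
  proof -
    \<comment> \<open>The target \<open>N * (j + 1) - (j + 1)\<close> represents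
      \<open>-(j + 1)\<close> modulo \<open>N\<close> by a natural number.\<close>
    obtain xs where xs: "fst ` set xs \<subseteq> K" "sep_list CHAR('k) xs"
      "[(\<Sum>(k, m)\<leftarrow>xs. k * m) = N * (j + 1) - (j + 1)] (mod N)"
      using exists_sep_list[where 'k = 'k, OF refl K(4,3) N] by blast
    define e where "e = (\<Sum>(k, m)\<leftarrow>xs. k * m)"
    have "[j + e + 1 = j + (N * (j + 1) - (j + 1)) + 1] (mod N)"
      unfolding e_def by (intro cong_add cong_refl xs)
    also have "j + (N * (j + 1) - (j + 1)) + 1 = N * (j + 1)" using N by (cases N) auto
    finally have "(j + e + 1) mod N = 0" by (simp add: cong_def)
    then have je: "(j + e) mod N = N - 1"
      using N by (metis Suc_eq_plus1 diff_Suc_1 mod_Suc nat.distinct(1))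
    define P where "P = (\<Sum>i\<le>Polynomial.degree H. if (i + e) mod N = N - 1
      then Polynomial.monom (Polynomial.coeff H i) ((i + e) div N) else 0)"
    have "poly P c = 0" for c
    proof -
      have "top_residue N c (H * Polynomial.monom 1 e) = 0"
        unfolding e_def
        by (intro polarise_list[OF inf linear_top_residue _ xs(1,2)]
            top_residue_power_eq_0[OF inf N K(1-3)] dec)
      also have "H * Polynomial.monom 1 e =
        (\<Sum>i\<le>Polynomial.degree H. Polynomial.monom (Polynomial.coeff H i) (i + e))"
        by (subst poly_as_sum_of_monoms[symmetric]) (simp add: sum_distrib_right mult_monom)
      also have "top_residue N c \<dots> = poly P c"
        unfolding linear_functional_sum[OF linear_top_residue] top_residue_monom[OF N] P_def poly_sum
        by (intro sum.cong) (auto simp: poly_monom)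
      finally show ?thesis by simp
    qed
    then have "P = 0" by (intro poly_eq_0_infinite_roots[OF inf])
    show ?thesis
    proof (cases "j \<le> Polynomial.degree H")
      case True
      have "0 = Polynomial.coeff P ((j + e) div N)" by (simp add: \<open>P = 0\<close>)
      also have "\<dots> = (\<Sum>i\<le>Polynomial.degree H. if i = j then Polynomial.coeff H j else 0)"
        unfolding P_def coeff_sum
      proof (intro sum.cong refl)
        fix i
        have "i = j" if "(i + e) mod N = N - 1" "(i + e) div N = (j + e) div N"
        proof -
          have "i + e = j + e" using that je by (metis div_mult_mod_eq)
          then show ?thesis by simp
        qed
        then show "Polynomial.coeff (if (i + e) mod N = N - 1
            then Polynomial.monom (Polynomial.coeff H i) ((i + e) div N) else 0) ((j + e) div N) =
          (if i = j then Polynomial.coeff H j else 0)"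
          using je by (auto simp: coeff_monom)
      qed
      also have "\<dots> = Polynomial.coeff H j" using True by simp
      finally show ?thesis ..
    qed (simp add: coeff_eq_0)
  qed
  then show ?thesis by (simp add: poly_eq_iff)
qed

section \<open>Bivariate polynomials\<close>

definition bicoeff :: "'k::field poly poly \<Rightarrow> nat \<Rightarrow> nat \<Rightarrow> 'k" where
  "bicoeff h i j = Polynomial.coeff (Polynomial.coeff h j) i"

definition xy_monom :: "nat \<Rightarrow> nat \<Rightarrow> 'k::field poly poly" where
  "xy_monom i j = var_x ^ i * var_y ^ j"

lemma xy_monom_conv: "xy_monom i j = Polynomial.monom (Polynomial.monom 1 i) j"
proof -
  have "var_x ^ i = [:Polynomial.monom (1 :: 'a) i:]"
    by (simp add: var_x_def poly_const_pow monom_altdef)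
  moreover have "var_y ^ j = (Polynomial.monom 1 j :: 'a poly poly)"
    by (simp add: var_y_def monom_altdef)
  ultimately show ?thesis by (simp add: xy_monom_def smult_monom)
qed

lemma xy_monom_mult: "xy_monom i j * xy_monom i' j' = xy_monom (i + i') (j + j')"
  by (simp add: xy_monom_conv mult_monom)

lemma xy_monom_power: "xy_monom i j ^ r = xy_monom (i * r) (j * r)"
  by (simp add: xy_monom_conv monom_power)

lemma xy_monom_0_0 [simp]: "xy_monom 0 0 = 1"
  by (simp add: xy_monom_def)

lemma bicoeff_simps [simp]:
  "bicoeff 0 i j = 0"
  "bicoeff (p + q) i j = bicoeff p i j + bicoeff q i j"
  "bicoeff (p - q) i j = bicoeff p i j - bicoeff q i j"
  "bicoeff ([:[:c:]:] * p) i j = c * bicoeff p i j"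
  by (simp_all add: bicoeff_def)

lemma bicoeff_xy_monom: "bicoeff (xy_monom s t) i j = (if i = s \<and> j = t then 1 else 0)"
  by (auto simp: bicoeff_def xy_monom_conv coeff_monom)

lemma bicoeff_mult_xy_monom:
  "bicoeff (h * xy_monom s t) i j = (if s \<le> i \<and> t \<le> j then bicoeff h (i - s) (j - t) else 0)"
  by (auto simp: bicoeff_def xy_monom_conv coeff_monom_mult mult.commute[of h])

lemma ideal_mem_if_monomials:
  fixes J :: "'k::field poly poly set"
  assumes J: "ideal J ring_of_type_algebra"
    and mon: "\<And>i j. bicoeff h i j \<noteq> 0 \<Longrightarrow> xy_monom i j \<in> J"
  shows "h \<in> J"
proof -
  have "Polynomial.monom (Polynomial.monom (bicoeff h i j) i) j \<in> J" for i j
  proof (cases "bicoeff h i j = 0")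
    case False
    then have "[:[:bicoeff h i j:]:] * xy_monom i j \<in> J"
      using mon J unfolding ideal_type_iff by blast
    then show ?thesis by (simp add: xy_monom_conv smult_monom)
  qed (use J in \<open>simp add: ideal_type_iff\<close>)
  then have "(\<Sum>j\<le>Polynomial.degree h. \<Sum>i\<le>Polynomial.degree (Polynomial.coeff h j).
      Polynomial.monom (Polynomial.monom (bicoeff h i j) i) j) \<in> J"
    by (intro ideal_sum_mem[OF J])
  also have "(\<Sum>j\<le>Polynomial.degree h. \<Sum>i\<le>Polynomial.degree (Polynomial.coeff h j).
      Polynomial.monom (Polynomial.monom (bicoeff h i j) i) j) =
    (\<Sum>j\<le>Polynomial.degree h. Polynomial.monom (Polynomial.coeff h j) j)"
  proof (rule sum.cong[OF refl])
    fix j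
    have "(\<Sum>i\<le>Polynomial.degree (Polynomial.coeff h j). Polynomial.monom (bicoeff h i j) i) =
        Polynomial.coeff h j"
      unfolding bicoeff_def by (rule poly_as_sum_of_monoms)
    then show "(\<Sum>i\<le>Polynomial.degree (Polynomial.coeff h j).
        Polynomial.monom (Polynomial.monom (bicoeff h i j) i) j) = Polynomial.monom (Polynomial.coeff h j) j"
      by (simp add: monom_sum flip: monom_sum)
  qed
  also have "\<dots> = h" by (rule poly_as_sum_of_monoms)
  finally show ?thesis .
qed

text \<open>The coefficients of \<open>x^a y^b X^(d-j) Y^j\<close> for \<open>X = x^\<delta>\<close>, \<open>Y = y^\<delta>\<close>, dehomogenised at \<open>X = 1\<close>.\<close>

definition slice :: "nat \<Rightarrow> nat \<Rightarrow> nat \<Rightarrow> nat \<Rightarrow> 'k::field poly poly \<Rightarrow> 'k poly" where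
  "slice \<delta> a b d h = (\<Sum>j\<le>d. Polynomial.monom (bicoeff h (a + \<delta> * (d - j)) (b + \<delta> * j)) j)"

lemma coeff_slice:
  "Polynomial.coeff (slice \<delta> a b d h) j =
    (if j \<le> d then bicoeff h (a + \<delta> * (d - j)) (b + \<delta> * j) else 0)"
  by (simp add: slice_def coeff_sum coeff_monom)

lemma slice_simps [simp]:
  "slice \<delta> a b d 0 = 0"
  "slice \<delta> a b d (p + q) = slice \<delta> a b d p + slice \<delta> a b d q"
  "slice \<delta> a b d (p - q) = slice \<delta> a b d p - slice \<delta> a b d q"
  "slice \<delta> a b d ([:[:c:]:] * p) = Polynomial.smult c (slice \<delta> a b d p)"
  by (auto simp: poly_eq_iff coeff_slice simp del: mult_pCons_left)

lemma slice_sum: "slice \<delta> a b d (sum f A) = (\<Sum>i\<in>A. slice \<delta> a b d (f i))"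
  by (induction A rule: infinite_finite_induct) auto

text \<open>For \<open>a < \<delta>\<close> the exponent \<open>a + \<delta> * m\<close> is at least
  \<open>\<delta> * m'\<close> exactly when \<open>m' \<le> m\<close>. Multiplication by monomials
  in \<open>X\<close> and \<open>Y\<close> therefore acts on each class of exponents modulo \<delta>
  separately.\<close>

lemma slice_mult_xy_monom:
  assumes "a < \<delta>" "b < \<delta>" "j \<le> N"
  shows "slice \<delta> a b d (h * xy_monom (\<delta> * (N - j)) (\<delta> * j)) =
    (if N \<le> d then Polynomial.monom 1 j * slice \<delta> a b (d - N) h else 0)"
proof -
  have le_iff: "\<delta> * m \<le> c + \<delta> * m' \<longleftrightarrow> m \<le> m'" if "c < \<delta>" for c m m' :: nat
  proof
    assume "\<delta> * m \<le> c + \<delta> * m'"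
    then have "\<delta> * m < \<delta> * Suc m'" using that by simp
    then show "m \<le> m'" by (simp only: nat_mult_less_cancel_disj less_Suc_eq_le)
  qed (simp add: trans_le_add2)
  have "Polynomial.coeff (slice \<delta> a b d (h * xy_monom (\<delta> * (N - j)) (\<delta> * j))) i =
    Polynomial.coeff (if N \<le> d then Polynomial.monom 1 j * slice \<delta> a b (d - N) h else 0) i" for i
  proof (cases "i \<le> d \<and> j \<le> i \<and> N - j \<le> d - i")
    case True
    then have "N \<le> d" "i - j \<le> d - N" "\<not> i < j" using assms(3) by auto
    moreover have "a + \<delta> * (d - i) - \<delta> * (N - j) = a + \<delta> * (d - N - (i - j))"
      "b + \<delta> * i - \<delta> * j = b + \<delta> * (i - j)"
    proof -
      have "d - i = (N - j) + (d - N - (i - j))" using True assms(3) by auto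
      then have "\<delta> * (d - i) = \<delta> * (N - j) + \<delta> * (d - N - (i - j))" by (metis distrib_left)
      then show "a + \<delta> * (d - i) - \<delta> * (N - j) = a + \<delta> * (d - N - (i - j))" by simp
      have "\<delta> * i = \<delta> * j + \<delta> * (i - j)" using True by (metis distrib_left le_add_diff_inverse)
      then show "b + \<delta> * i - \<delta> * j = b + \<delta> * (i - j)" by simp
    qed
    ultimately show ?thesis
      using True le_iff[OF assms(1)] le_iff[OF assms(2)]
      by (simp add: coeff_slice bicoeff_mult_xy_monom coeff_monom_mult)
  next
    case False
    have "Polynomial.coeff (slice \<delta> a b d (h * xy_monom (\<delta> * (N - j)) (\<delta> * j))) i = 0"
      using False le_iff[OF assms(1)] le_iff[OF assms(2)]
      by (auto simp: coeff_slice bicoeff_mult_xy_monom)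
    moreover have "N \<le> d \<Longrightarrow> i < j \<or> \<not> i - j \<le> d - N" using False assms(3) by auto
    ultimately show ?thesis by (auto simp: coeff_slice coeff_monom_mult)
  qed
  then show ?thesis by (rule poly_eqI)
qed

section \<open>Homogenisation in \<open>X\<close> and \<open>Y\<close>\<close>

definition homogenize :: "nat \<Rightarrow> nat \<Rightarrow> 'k::field poly \<Rightarrow> 'k poly poly" where
  "homogenize \<delta> N p = (\<Sum>j\<le>N. [:[:Polynomial.coeff p j:]:] * xy_monom (\<delta> * (N - j)) (\<delta> * j))"

lemma homogenize_add: "homogenize \<delta> N (p + q) = homogenize \<delta> N p + homogenize \<delta> N q"
proof -
  have "[:[:a + b:]:] = [:[:a:]:] + [:[:b:]:]" for a b :: 'a by simp
  then show ?thesis by (simp only: homogenize_def coeff_add distrib_right sum.distrib)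
qed

lemma homogenize_sum: "homogenize \<delta> N (sum f A) = (\<Sum>i\<in>A. homogenize \<delta> N (f i))"
proof (induction A rule: infinite_finite_induct)
  case (insert x F)
  then show ?case by (simp add: homogenize_add)
qed (auto simp: homogenize_def)

lemma homogenize_monom:
  assumes "j \<le> N"
  shows "homogenize \<delta> N (Polynomial.monom c j) = [:[:c:]:] * xy_monom (\<delta> * (N - j)) (\<delta> * j)"
proof -
  have "homogenize \<delta> N (Polynomial.monom c j) =
    (\<Sum>i\<le>N. if i = j then [:[:c:]:] * xy_monom (\<delta> * (N - j)) (\<delta> * j) else 0)"
    unfolding homogenize_def by (intro sum.cong) (auto simp: coeff_monom)
  then show ?thesis using assms by simp
qed

lemma homogenize_mult:
  assumes "Polynomial.degree p \<le> N" "Polynomial.degree q \<le> M"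
  shows "homogenize \<delta> (N + M) (p * q) = homogenize \<delta> N p * homogenize \<delta> M q"
proof -
  have "p * q = (\<Sum>i\<le>N. \<Sum>j\<le>M. Polynomial.monom (Polynomial.coeff p i * Polynomial.coeff q j) (i + j))"
    unfolding mult_monom[symmetric] sum_product[symmetric]
    using poly_as_sum_of_monoms'[OF assms(1)] poly_as_sum_of_monoms'[OF assms(2)] by simp
  then have "homogenize \<delta> (N + M) (p * q) =
    (\<Sum>i\<le>N. \<Sum>j\<le>M. [:[:Polynomial.coeff p i * Polynomial.coeff q j:]:] *
      xy_monom (\<delta> * (N + M - (i + j))) (\<delta> * (i + j)))"
    by (simp only: homogenize_sum) (intro sum.cong refl homogenize_monom, auto)
  also have "\<dots> = (\<Sum>i\<le>N. \<Sum>j\<le>M. ([:[:Polynomial.coeff p i:]:] * xy_monom (\<delta> * (N - i)) (\<delta> * i)) *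
      ([:[:Polynomial.coeff q j:]:] * xy_monom (\<delta> * (M - j)) (\<delta> * j)))"
  proof (intro sum.cong refl)
    fix i j assume "i \<in> {..N}" "j \<in> {..M}"
    then have "N + M - (i + j) = (N - i) + (M - j)" by auto
    then have "xy_monom (\<delta> * (N + M - (i + j))) (\<delta> * (i + j)) =
      xy_monom (\<delta> * (N - i)) (\<delta> * i) * (xy_monom (\<delta> * (M - j)) (\<delta> * j) :: 'a poly poly)"
      by (simp add: xy_monom_mult distrib_left)
    moreover have "[:[:Polynomial.coeff p i * Polynomial.coeff q j:]:] =
      [:[:Polynomial.coeff p i:]:] * [:[:Polynomial.coeff q j:]:]" by simp
    ultimately show "[:[:Polynomial.coeff p i * Polynomial.coeff q j:]:] *
        xy_monom (\<delta> * (N + M - (i + j))) (\<delta> * (i + j)) =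
      ([:[:Polynomial.coeff p i:]:] * xy_monom (\<delta> * (N - i)) (\<delta> * i)) *
      ([:[:Polynomial.coeff q j:]:] * xy_monom (\<delta> * (M - j)) (\<delta> * j))"
      by (simp only: mult_ac)
  qed
  also have "\<dots> = homogenize \<delta> N p * homogenize \<delta> M q"
    unfolding homogenize_def sum_product ..
  finally show ?thesis .
qed

lemma homogenize_mem:
  assumes "ideal J ring_of_type_algebra" "p \<in> polys_on S"
    and "\<And>e. e \<in> S \<Longrightarrow> xy_monom (\<delta> * (N - e)) (\<delta> * e) \<in> J"
  shows "homogenize \<delta> N p \<in> J"
  unfolding homogenize_def
proof (rule ideal_sum_mem[OF assms(1)])
  fix j
  show "[:[:Polynomial.coeff p j:]:] * xy_monom (\<delta> * (N - j)) (\<delta> * j) \<in> J"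
  proof (cases "Polynomial.coeff p j = 0")
    case False
    then have "xy_monom (\<delta> * (N - j)) (\<delta> * j) \<in> J" using assms by (auto simp: polys_on_def)
    then show ?thesis using assms(1) unfolding ideal_type_iff by blast
  qed (use assms(1) in \<open>simp add: ideal_type_iff\<close>)
qed

text \<open>Translates a multiple of a form in \<open>X\<close>, \<open>Y\<close> into a multiple in
  \<open>k[Y]\<close>, with the degree of the cofactor slice lowered by \<open>N\<close>.\<close>

lemma slice_mult_homogenize:
  assumes "a < \<delta>" "b < \<delta>" "Polynomial.degree p \<le> N"
  shows "slice \<delta> a b d (h * homogenize \<delta> N p) = (if N \<le> d then p * slice \<delta> a b (d - N) h else 0)"
proof -
  have "slice \<delta> a b d (h * homogenize \<delta> N p) =
    (\<Sum>j\<le>N. Polynomial.smult (Polynomial.coeff p j) (slice \<delta> a b d (h * xy_monom (\<delta> * (N - j)) (\<delta> * j))))"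
    unfolding homogenize_def sum_distrib_left slice_sum mult.left_commute[of h] slice_simps ..
  also have "\<dots> = (\<Sum>j\<le>N. Polynomial.smult (Polynomial.coeff p j)
      (if N \<le> d then Polynomial.monom 1 j * slice \<delta> a b (d - N) h else 0))"
    using assms by (intro sum.cong) (auto simp: slice_mult_xy_monom)
  also have "\<dots> = (if N \<le> d then (\<Sum>j\<le>N. Polynomial.monom (Polynomial.coeff p j) j) * slice \<delta> a b (d - N) h else 0)"
    by (auto simp: sum_distrib_right smult_monom simp flip: mult_smult_left)
  finally show ?thesis using poly_as_sum_of_monoms'[OF assms(3)] by simp
qed

section \<open>Ideals generated by monomials of one degree in \<open>X\<close> and
  \<open>Y\<close>\<close>

definition mono_ideal :: "nat \<Rightarrow> nat \<Rightarrow> nat set \<Rightarrow> 'k::field poly poly set" where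
  "mono_ideal \<delta> d S = Idl\<^bsub>ring_of_type_algebra\<^esub> ((\<lambda>e. xy_monom (\<delta> * (d - e)) (\<delta> * e)) ` S)"

lemma ideal_mono_ideal [simp]: "ideal (mono_ideal \<delta> d S) ring_of_type_algebra"
  by (simp add: mono_ideal_def)

lemma mono_ideal_mem: "e \<in> S \<Longrightarrow> xy_monom (\<delta> * (d - e)) (\<delta> * e) \<in> mono_ideal \<delta> d S"
  by (auto simp: mono_ideal_def intro: Idl_mem)

lemma mono_ideal_prod:
  assumes "S \<subseteq> {..d}" "U \<subseteq> {..d'}"
  shows "(mono_ideal \<delta> d S :: 'k::field poly poly set) \<cdot>\<^bsub>ring_of_type_algebra\<^esub> mono_ideal \<delta> d' U =
    mono_ideal \<delta> (d + d') {e + k | e k. e \<in> S \<and> k \<in> U}"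
proof -
  have eq: "xy_monom (\<delta> * (d - e)) (\<delta> * e) * xy_monom (\<delta> * (d' - k)) (\<delta> * k) =
    (xy_monom (\<delta> * (d + d' - (e + k))) (\<delta> * (e + k)) :: 'k poly poly)" if "e \<in> S" "k \<in> U" for e k
  proof -
    have "d + d' - (e + k) = (d - e) + (d' - k)" using assms that by force
    then show ?thesis by (simp add: xy_monom_mult distrib_left)
  qed
  have "{x * y |x y. x \<in> (\<lambda>e. xy_monom (\<delta> * (d - e)) (\<delta> * e)) ` S \<and>
      y \<in> (\<lambda>e. xy_monom (\<delta> * (d' - e)) (\<delta> * e)) ` U} =
    (\<lambda>e. xy_monom (\<delta> * (d + d' - e)) (\<delta> * e) :: 'k poly poly) ` {e + k | e k. e \<in> S \<and> k \<in> U}"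
    (is "?A = ?B")
  proof
    show "?A \<subseteq> ?B" by (auto simp: eq intro!: imageI) blast
    show "?B \<subseteq> ?A"
    proof
      fix z assume "z \<in> ?B"
      then obtain e k where "e \<in> S" "k \<in> U"
        "z = xy_monom (\<delta> * (d + d' - (e + k))) (\<delta> * (e + k))" by blast
      then show "z \<in> ?A" unfolding eq[symmetric, OF \<open>e \<in> S\<close> \<open>k \<in> U\<close>] by blast
    qed
  qed
  then show ?thesis unfolding mono_ideal_def ideal_prod_Idl by simp
qed

lemma mono_ideal_power:
  assumes "K \<subseteq> {..N}"
  shows "ideal_power ring_of_type_algebra (mono_ideal \<delta> N K :: 'k::field poly poly set) r =
    mono_ideal \<delta> (N * r) (sumset_pow K r)"
proof (induction r)
  case 0
  have id: "ideal (mono_ideal \<delta> 0 {0} :: 'k poly poly set) ring_of_type_algebra" by simp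
  have "1 \<in> (mono_ideal \<delta> 0 {0} :: 'k poly poly set)" using mono_ideal_mem[of 0 "{0}" \<delta> 0] by simp
  then have "x * 1 \<in> (mono_ideal \<delta> 0 {0} :: 'k poly poly set)" for x
    using id unfolding ideal_type_iff by blast
  then show ?case by auto
next
  case (Suc r)
  have "ideal_power ring_of_type_algebra (mono_ideal \<delta> N K :: 'k poly poly set) (Suc r) =
    mono_ideal \<delta> (N * r) (sumset_pow K r) \<cdot>\<^bsub>ring_of_type_algebra\<^esub> mono_ideal \<delta> N K"
    unfolding ideal_power_Suc Suc.IH ..
  also have "\<dots> = mono_ideal \<delta> (N * r + N) (sumset_pow K (Suc r))"
    unfolding sumset_pow.simps by (rule mono_ideal_prod) (use sumset_pow_le[OF assms] assms in auto)
  finally show ?case by (simp add: add.commute del: sumset_pow.simps)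
qed

section \<open>The power of the ideal lies in every reduction\<close>

text \<open>For \<delta> > 0 this is the ideal \<open>(x^\<delta>, y^\<delta>)^d\<close>, described
  by its monomials: \<open>x^i y^j\<close> is a multiple of some \<open>X^s Y^t\<close> with
  \<open>s + t = d\<close> exactly when the two floors add up to at least \<open>d\<close>.\<close>

definition floor_order_ge :: "nat \<Rightarrow> nat \<Rightarrow> 'k::field poly poly set" where
  "floor_order_ge \<delta> d = {h. \<forall>i j. bicoeff h i j \<noteq> 0 \<longrightarrow> d \<le> i div \<delta> + j div \<delta>}"

lemma floor_order_ge_add:
  assumes "p \<in> floor_order_ge \<delta> d" "q \<in> floor_order_ge \<delta> d"
  shows "p + q \<in> floor_order_ge \<delta> d"
  unfolding floor_order_ge_def
proof (intro CollectI allI impI)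
  fix i j assume "bicoeff (p + q) i j \<noteq> 0"
  then have "bicoeff p i j \<noteq> 0 \<or> bicoeff q i j \<noteq> 0" by auto
  then show "d \<le> i div \<delta> + j div \<delta>" using assms by (auto simp: floor_order_ge_def)
qed

lemma floor_order_ge_mult:
  assumes "p \<in> floor_order_ge \<delta> d" "q \<in> floor_order_ge \<delta> d'"
  shows "p * q \<in> floor_order_ge \<delta> (d + d')"
  unfolding floor_order_ge_def
proof (intro CollectI allI impI)
  fix i j assume "bicoeff (p * q) i j \<noteq> 0"
  then have "(\<Sum>j1\<le>j. \<Sum>i1\<le>i. bicoeff p i1 j1 * bicoeff q (i - i1) (j - j1)) \<noteq> 0"
    by (simp add: bicoeff_def coeff_mult coeff_sum)
  then obtain i1 j1 where ij: "i1 \<le> i" "j1 \<le> j" "bicoeff p i1 j1 * bicoeff q (i - i1) (j - j1) \<noteq> 0"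
    by (meson atMost_iff sum.neutral)
  then have "d \<le> i1 div \<delta> + j1 div \<delta>" "d' \<le> (i - i1) div \<delta> + (j - j1) div \<delta>"
    using assms by (auto simp: floor_order_ge_def)
  moreover have sub: "a div \<delta> + b div \<delta> \<le> (a + b) div \<delta>" for a b
    unfolding div_add1_eq[of a b \<delta>] by simp
  moreover have "i1 div \<delta> + (i - i1) div \<delta> \<le> i div \<delta>" "j1 div \<delta> + (j - j1) div \<delta> \<le> j div \<delta>"
    using sub[of i1 "i - i1"] sub[of j1 "j - j1"] ij(1,2) by simp_all
  ultimately show "d + d' \<le> i div \<delta> + j div \<delta>"
    by linarith
qed

lemma ideal_floor_order_ge: "ideal (floor_order_ge \<delta> d) ring_of_type_algebra"
  unfolding ideal_type_iff
proof (intro conjI ballI allI)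
  show "0 \<in> floor_order_ge \<delta> d" by (simp add: floor_order_ge_def)
  show "r * a \<in> floor_order_ge \<delta> d" if "a \<in> floor_order_ge \<delta> d" for a r
    using floor_order_ge_mult[of r \<delta> 0 a d] that by (simp add: floor_order_ge_def)
qed (rule floor_order_ge_add)

lemma xy_monom_floor_order_ge: "d \<le> i div \<delta> + j div \<delta> \<Longrightarrow> xy_monom i j \<in> floor_order_ge \<delta> d"
  by (auto simp: floor_order_ge_def bicoeff_xy_monom)

lemma mono_ideal_floor_order_ge:
  assumes "0 < \<delta>" "S \<subseteq> {..d}"
  shows "mono_ideal \<delta> d S \<subseteq> floor_order_ge \<delta> d"
  unfolding mono_ideal_def
  by (rule Idl_subset[OF ideal_floor_order_ge])
    (use assms in \<open>auto intro!: xy_monom_floor_order_ge\<close>)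

lemma homogenize_floor_order_ge:
  assumes "0 < \<delta>" "Polynomial.degree p \<le> d"
  shows "homogenize \<delta> d p \<in> floor_order_ge \<delta> d"
proof (rule homogenize_mem[OF ideal_floor_order_ge])
  show "p \<in> polys_on {..d}"
    using assms(2) by (auto simp: polys_on_def intro: le_trans[OF le_degree])
qed (use assms(1) in \<open>auto intro!: xy_monom_floor_order_ge\<close>)

text \<open>The degree forms of \<open>J\<close> of degree \<open>N\<close> have no common zero and one of them has full degree, so
  by division with remainder their multiples contain all forms of degree \<open>2 * N - 1\<close>.\<close>

lemma reduction_slices:
  fixes J :: "'k::field poly poly set"
  assumes \<delta>: "0 < \<delta>" and N: "0 < N" and K: "K \<subseteq> {..N}" "0 \<in> K" "N \<in> K"
    and J: "is_reduction ring_of_type_algebra (mono_ideal \<delta> N K) J"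
    and j: "j \<le> 2 * N - 1"
  shows "\<exists>h\<in>J \<inter> floor_order_ge \<delta> (2 * N - 1). slice \<delta> 0 0 (2 * N - 1) h = Polynomial.monom 1 j"
proof -
  have idJ: "ideal J ring_of_type_algebra" and JI: "J \<subseteq> mono_ideal \<delta> N K"
    using J by (auto simp: is_reduction_def)
  let ?P = "ideal_power ring_of_type_algebra (mono_ideal \<delta> N K :: 'k poly poly set)"
  obtain r where r: "?P (r + 1) = J \<cdot>\<^bsub>ring_of_type_algebra\<^esub> ?P r"
    using J by (auto simp: is_reduction_def simp del: ideal_power_Suc)
  define \<Phi> where "\<Phi> d = (slice \<delta> 0 0 d :: 'k poly poly \<Rightarrow> 'k poly)" for d
  have N': "N + (N - 1) = 2 * N - 1" using N by simp
  \<comment> \<open>It suffices that \<open>V\<close> contains every \<open>Y^j\<close> with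
    \<open>j \<le> 2 * N - 1\<close>. Elements of \<open>J\<close> have order at least
    \<open>N\<close>, so multiplying them by forms of degree \<open>N - 1\<close> puts products
    \<open>\<Phi> N h * p\<close> into \<open>V\<close>.\<close>
  define V where "V = \<Phi> (2 * N - 1) ` (J \<inter> floor_order_ge \<delta> (2 * N - 1))"
  have V_deg: "Polynomial.degree w \<le> 2 * N - 1" if "w \<in> V" for w
    using that by (auto simp: V_def \<Phi>_def coeff_slice intro!: degree_le)
  have V0: "0 \<in> V"
    using idJ ideal_floor_order_ge[of \<delta> "2 * N - 1"]
    by (auto simp: V_def \<Phi>_def ideal_type_iff intro!: image_eqI[of _ _ 0])
  have V_add: "p + q \<in> V" if pq: "p \<in> V" "q \<in> V" for p q
  proof -
    obtain g h where "g \<in> J \<inter> floor_order_ge \<delta> (2 * N - 1)" "p = \<Phi> (2 * N - 1) g"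
      "h \<in> J \<inter> floor_order_ge \<delta> (2 * N - 1)" "q = \<Phi> (2 * N - 1) h"
      using pq unfolding V_def by blast
    moreover have "g + h \<in> J" using idJ calculation unfolding ideal_type_iff by blast
    ultimately show ?thesis using floor_order_ge_add[of g \<delta> "2 * N - 1" h]
      by (auto simp: V_def \<Phi>_def intro!: image_eqI[of _ _ "g + h"])
  qed
  have V_mult: "\<Phi> N h * p \<in> V" if h: "h \<in> J" and p: "Polynomial.degree p \<le> N - 1" for h p
  proof -
    let ?g = "h * homogenize \<delta> (N - 1) p"
    have "?g \<in> J" using idJ h unfolding ideal_type_iff by (metis mult.commute)
    moreover have "h \<in> floor_order_ge \<delta> N"
      using h JI mono_ideal_floor_order_ge[OF \<delta> K(1)] by auto
    then have "?g \<in> floor_order_ge \<delta> (2 * N - 1)"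
      using floor_order_ge_mult homogenize_floor_order_ge[OF \<delta> p] N' by metis
    moreover have "\<Phi> (2 * N - 1) ?g = \<Phi> N h * p"
    proof -
      have "2 * N - 1 - (N - 1) = N" "N - 1 \<le> 2 * N - 1" using N by auto
      then show ?thesis unfolding \<Phi>_def using slice_mult_homogenize[OF \<delta> \<delta> p, of "2 * N - 1" h] by simp
    qed
    ultimately show ?thesis unfolding V_def by (metis IntI imageI)
  qed
  have P_eq: "?P m = Idl\<^bsub>ring_of_type_algebra\<^esub>
      ((\<lambda>e. xy_monom (\<delta> * (N * m - e)) (\<delta> * e)) ` sumset_pow K m)" for m
    by (subst mono_ideal_power[OF K(1)], subst mono_ideal_def) (rule refl)
  have \<Phi>_mult: "\<Phi> (N * (r + 1)) (h * xy_monom (\<delta> * (N * r - e)) (\<delta> * e)) = Polynomial.monom 1 e * \<Phi> N h"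
    if "e \<in> sumset_pow K r" for h e
  proof -
    have "e \<le> N * r" using that sumset_pow_le[OF K(1)] by auto
    then show ?thesis unfolding \<Phi>_def using slice_mult_xy_monom[OF \<delta> \<delta>, of e "N * r" "N * (r + 1)" h] by simp
  qed
  have mem_P: "xy_monom (\<delta> * (N * (r + 1) - e)) (\<delta> * e) \<in> J \<cdot>\<^bsub>ring_of_type_algebra\<^esub> ?P r"
    if "e \<in> sumset_pow K (r + 1)" for e
  proof -
    have "xy_monom (\<delta> * (N * (r + 1) - e)) (\<delta> * e) \<in> ?P (r + 1)"
      unfolding P_eq using that by (intro Idl_mem imageI)
    then show ?thesis unfolding r .
  qed
  have \<Phi>_monom: "\<Phi> (N * (r + 1)) (xy_monom (\<delta> * (N * (r + 1) - e)) (\<delta> * e)) = Polynomial.monom 1 e"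
    if "e \<le> N * (r + 1)" for e
    using slice_mult_xy_monom[OF \<delta> \<delta> that, of "N * (r + 1)" 1]
    by (auto simp: \<Phi>_def slice_def bicoeff_def coeff_1 one_pCons coeff_pCons poly_eq_iff)
  \<comment> \<open>Otherwise no element of \<open>J\<close> times the \<open>r\<close>-th power
    could contain \<open>Y^(N (r + 1))\<close>, although this monomial lies in the power
    \<open>r + 1\<close>.\<close>
  have "\<exists>h0\<in>J. Polynomial.coeff (\<Phi> N h0) N \<noteq> 0"
  proof (rule ccontr)
    assume "\<not> ?thesis"
    then have zero: "Polynomial.coeff (\<Phi> N h) N = 0" if "h \<in> J" for h using that by blast
    have "J \<cdot>\<^bsub>ring_of_type_algebra\<^esub> ?P r \<subseteq> {z. Polynomial.coeff (\<Phi> (N * (r + 1)) z) (N * (r + 1)) = 0}"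
      unfolding P_eq
    proof (rule ideal_prod_Idl_subset[OF idJ])
      fix h s :: "'k poly poly" assume h: "h \<in> J" and "s \<in> (\<lambda>e. xy_monom (\<delta> * (N * r - e)) (\<delta> * e)) ` sumset_pow K r"
      then obtain e where e: "e \<in> sumset_pow K r" "s = xy_monom (\<delta> * (N * r - e)) (\<delta> * e)" by blast
      have "e \<le> N * r" using e(1) sumset_pow_le[OF K(1)] by auto
      then have "Polynomial.coeff (\<Phi> N h) (N * (r + 1) - e) = 0"
        using zero[OF h] by (cases "e = N * r") (auto simp: \<Phi>_def coeff_slice)
      then show "h * s \<in> {z. Polynomial.coeff (\<Phi> (N * (r + 1)) z) (N * (r + 1)) = 0}"
        unfolding e(2) mem_Collect_eq \<Phi>_mult[OF e(1)] by (simp only: coeff_monom_mult) simp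
    qed (auto simp: \<Phi>_def)
    moreover have "N * (r + 1) \<in> sumset_pow K (r + 1)"
      using mult_mem_sumset_pow[OF K(3), of "r + 1"] by (simp only: mult.commute)
    then have "xy_monom (\<delta> * (N * (r + 1) - N * (r + 1))) (\<delta> * (N * (r + 1))) \<in>
        J \<cdot>\<^bsub>ring_of_type_algebra\<^esub> ?P r" by (rule mem_P)
    ultimately have "Polynomial.coeff (\<Phi> (N * (r + 1))
        (xy_monom (\<delta> * (N * (r + 1) - N * (r + 1))) (\<delta> * (N * (r + 1))))) (N * (r + 1)) = 0"
      by blast
    then show False unfolding \<Phi>_monom[OF order_refl] by (simp add: coeff_monom)
  qed
  then obtain h0 where h0: "h0 \<in> J" "Polynomial.coeff (\<Phi> N h0) N \<noteq> 0" by blast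
  define F where "F = \<Phi> N h0"
  have degF: "Polynomial.degree F = N"
    using h0(2) unfolding F_def
    by (intro antisym degree_le le_degree) (auto simp: \<Phi>_def coeff_slice)
  have "F \<noteq> 0" using degF N by auto
  \<comment> \<open>Membership in \<open>V\<close> modulo multiples of \<open>F\<close>. Multipliers
    may be reduced modulo \<open>F\<close> to degree at most \<open>N - 1\<close>, so arbitrary
    multiples of \<open>\<Phi> N h\<close> qualify.\<close>
  define Ok where "Ok u \<longleftrightarrow> (\<exists>w\<in>V. F dvd u - w)" for u
  have Ok_add: "Ok (p + q)" if pq: "Ok p" "Ok q" for p q
  proof -
    obtain w w' where w: "w \<in> V" "F dvd p - w" "w' \<in> V" "F dvd q - w'" using pq unfolding Ok_def by blast
    have "F dvd (p - w) + (q - w')" using w by (intro dvd_add)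
    also have "(p - w) + (q - w') = (p + q) - (w + w')" by simp
    finally show ?thesis unfolding Ok_def using V_add w by blast
  qed
  have Ok_mult: "Ok (\<Phi> N h * B)" if h: "h \<in> J" for h B
    unfolding Ok_def
  proof (rule bexI)
    have "\<Phi> N h * B - \<Phi> N h * (B mod F) = \<Phi> N h * (F * (B div F))"
      by (metis right_diff_distrib minus_mod_eq_mult_div)
    then show "F dvd \<Phi> N h * B - \<Phi> N h * (B mod F)" by simp
    have "Polynomial.degree (B mod F) \<le> N - 1"
      using degree_mod_less[OF \<open>F \<noteq> 0\<close>, of B] degF N by auto
    then show "\<Phi> N h * (B mod F) \<in> V" by (rule V_mult[OF h])
  qed
  have "J \<cdot>\<^bsub>ring_of_type_algebra\<^esub> ?P r \<subseteq> {z. \<forall>B. Ok (\<Phi> (N * (r + 1)) z * B)}"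
    unfolding P_eq
  proof (rule ideal_prod_Idl_subset[OF idJ])
    have "Ok 0" unfolding Ok_def using V0 by force
    then show "0 \<in> {z. \<forall>B. Ok (\<Phi> (N * (r + 1)) z * B)}" by (simp add: \<Phi>_def)
    show "a + b \<in> {z. \<forall>B. Ok (\<Phi> (N * (r + 1)) z * B)}"
      if "a \<in> {z. \<forall>B. Ok (\<Phi> (N * (r + 1)) z * B)}" "b \<in> {z. \<forall>B. Ok (\<Phi> (N * (r + 1)) z * B)}" for a b
      using that Ok_add by (simp add: \<Phi>_def distrib_right)
    fix h s :: "'k poly poly" assume h: "h \<in> J" and "s \<in> (\<lambda>e. xy_monom (\<delta> * (N * r - e)) (\<delta> * e)) ` sumset_pow K r"
    then obtain e where e: "e \<in> sumset_pow K r" "s = xy_monom (\<delta> * (N * r - e)) (\<delta> * e)" by blast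
    have "Ok (\<Phi> (N * (r + 1)) (h * s) * B)" for B
      unfolding e(2) \<Phi>_mult[OF e(1)] using Ok_mult[OF h, of "Polynomial.monom 1 e * B"]
      by (simp only: mult_ac)
    then show "h * s \<in> {z. \<forall>B. Ok (\<Phi> (N * (r + 1)) z * B)}" by blast
  qed
  \<comment> \<open>The generator \<open>X^(N (r + 1))\<close> dehomogenises to 1: this is how the
    slices of \<open>J\<close> come to generate the unit ideal.\<close>
  then have "Ok (\<Phi> (N * (r + 1)) (xy_monom (\<delta> * (N * (r + 1) - 0)) (\<delta> * 0)) * Polynomial.monom 1 j)"
    using mem_P[OF zero_mem_sumset_pow[OF K(2)]] by blast
  then have "Ok (Polynomial.monom 1 j)" unfolding \<Phi>_monom[OF le0] by simp
  then obtain w A where w: "w \<in> V" and A: "Polynomial.monom 1 j - w = F * A"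
    unfolding Ok_def by (metis dvdE)
  \<comment> \<open>Since \<open>F\<close> has degree exactly \<open>N\<close>, the bound
    \<open>2 * N - 1\<close> on the difference leaves \<open>A\<close> degree at most
    \<open>N - 1\<close>, so the correction lies in \<open>V\<close> too.\<close>
  have "F * A \<in> V"
  proof (cases "A = 0")
    case False
    have "Polynomial.degree (F * A) \<le> 2 * N - 1"
      unfolding A[symmetric] using V_deg[OF w] j by (intro degree_diff_le) (auto simp: degree_monom_eq)
    then have "Polynomial.degree A \<le> N - 1"
      using False \<open>F \<noteq> 0\<close> degF by (simp add: degree_mult_eq)
    then show ?thesis unfolding F_def by (rule V_mult[OF h0(1)])
  qed (simp add: V0)
  then have "w + F * A \<in> V" using V_add w by blast
  then show ?thesis unfolding A[symmetric] V_def \<Phi>_def by auto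
qed

text \<open>Descending induction on the total degree. Monomials divisible by \<open>x^E\<close> or
  \<open>y^E\<close> lie in \<open>J\<close>. For any other one, \<open>reduction_slices\<close>
  replaces a divisor \<open>X^s Y^t\<close> by an element of \<open>J\<close>, up to a remainder
  whose monomials have larger total degree.\<close>

lemma mono_ideal_subset_reduction:
  fixes J :: "'k::field poly poly set"
  assumes \<delta>: "0 < \<delta>" and N: "0 < N" and K: "K \<subseteq> {..N}" "0 \<in> K" "N \<in> K"
    and J: "is_reduction ring_of_type_algebra (mono_ideal \<delta> N K) J"
  shows "mono_ideal \<delta> (2 * N - 1) {..2 * N - 1} \<subseteq> J"
proof -
  have idJ: "ideal J ring_of_type_algebra" using J by (auto simp: is_reduction_def)
  let ?P = "ideal_power ring_of_type_algebra (mono_ideal \<delta> N K :: 'k poly poly set)"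
  obtain r where r: "?P (r + 1) = J \<cdot>\<^bsub>ring_of_type_algebra\<^esub> ?P r"
    using J by (auto simp: is_reduction_def simp del: ideal_power_Suc)
  define E where "E = \<delta> * (N * (r + 1))"
  have PJ: "?P (r + 1) \<subseteq> J"
  proof -
    interpret cring "ring_of_type_algebra :: 'k poly poly ring" by (rule cring_from_type_algebra)
    show ?thesis unfolding r using ideal_prod_inter[OF idJ, of "?P r"] by simp
  qed
  have J_mult: "q * p \<in> J" if "p \<in> J" for p q using idJ that unfolding ideal_type_iff by blast
  have "xy_monom (\<delta> * (N * (r + 1) - e)) (\<delta> * e) \<in> J" if "e \<in> sumset_pow K (r + 1)" for e
    using mono_ideal_mem[OF that, of \<delta> "N * (r + 1)"] PJ mono_ideal_power[OF K(1), of \<delta> "r + 1"] by blast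
  from this[OF zero_mem_sumset_pow[OF K(2)]] this[OF mult_mem_sumset_pow[OF K(3)]]
  have xE: "xy_monom E 0 \<in> J" and yE: "xy_monom 0 E \<in> J"
    by (simp_all add: E_def mult.commute[of "Suc r"] del: mult_Suc_right mult_Suc)
  have mem: "xy_monom i j \<in> J" if "2 * N - 1 \<le> i div \<delta> + j div \<delta>" for i j
    using that
  proof (induction "2 * E - (i + j)" arbitrary: i j rule: less_induct)
    case less
    show ?case
    proof (cases "E \<le> i \<or> E \<le> j")
      case True
      then show ?thesis
      proof
        assume "E \<le> i"
        then have "xy_monom i j = xy_monom (i - E) j * (xy_monom E 0 :: 'k poly poly)" by (simp add: xy_monom_mult)
        then show ?thesis using J_mult[OF xE] by simp
      next
        assume "E \<le> j"
        then have "xy_monom i j = xy_monom i (j - E) * (xy_monom 0 E :: 'k poly poly)" by (simp add: xy_monom_mult)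
        then show ?thesis using J_mult[OF yE] by simp
      qed
    next
      case False
      \<comment> \<open>This picks a monomial \<open>X^s Y^t\<close> with
        \<open>s + t = 2 * N - 1\<close> dividing \<open>x^i y^j\<close>.\<close>
      define t where "t = min (j div \<delta>) (2 * N - 1)"
      define s where "s = 2 * N - 1 - t"
      have st: "s + t = 2 * N - 1" "s \<le> i div \<delta>" "t \<le> j div \<delta>"
        using less.prems by (auto simp: s_def t_def)
      have le: "\<delta> * s \<le> i" "\<delta> * t \<le> j"
        using st mult_le_mono2[of _ _ \<delta>] by (metis le_trans times_div_less_eq_dividend)+
      obtain h where h: "h \<in> J" "h \<in> floor_order_ge \<delta> (2 * N - 1)"
        "slice \<delta> 0 0 (2 * N - 1) h = Polynomial.monom 1 t"
        using reduction_slices[OF \<delta> N K J, of t] st by auto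
      define d where "d = xy_monom (\<delta> * s) (\<delta> * t) - h"
      have d_order: "d \<in> floor_order_ge \<delta> (2 * N - 1)"
        unfolding d_def using st \<delta> by (intro ideal_diff_mem[OF ideal_floor_order_ge] xy_monom_floor_order_ge h) simp
      have d_slice: "slice \<delta> 0 0 (2 * N - 1) d = 0"
      proof (rule poly_eqI)
        fix m
        have "Polynomial.coeff (slice \<delta> 0 0 (2 * N - 1) h) m = (if t = m then 1 else 0)"
          unfolding h(3) by (simp add: coeff_monom)
        moreover have "Polynomial.coeff (slice \<delta> 0 0 (2 * N - 1) (xy_monom (\<delta> * s) (\<delta> * t) :: 'k poly poly)) m =
            (if t = m then 1 else 0)"
          using st \<delta> by (auto simp: coeff_slice bicoeff_xy_monom)
        ultimately show "Polynomial.coeff (slice \<delta> 0 0 (2 * N - 1) d) m = Polynomial.coeff 0 m"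
          by (simp add: d_def)
      qed
      have "d * xy_monom (i - \<delta> * s) (j - \<delta> * t) \<in> J"
      proof (rule ideal_mem_if_monomials[OF idJ])
        fix p q
        assume "bicoeff (d * xy_monom (i - \<delta> * s) (j - \<delta> * t)) p q \<noteq> 0"
        then have pq: "i - \<delta> * s \<le> p" "j - \<delta> * t \<le> q"
          and nz: "bicoeff d (p - (i - \<delta> * s)) (q - (j - \<delta> * t)) \<noteq> 0"
          by (auto simp: bicoeff_mult_xy_monom split: if_splits)
        define p' q' where "p' = p - (i - \<delta> * s)" and "q' = q - (j - \<delta> * t)"
        have ge: "2 * N - 1 \<le> p' div \<delta> + q' div \<delta>"
          using d_order nz unfolding floor_order_ge_def p'_def q'_def by blast
        \<comment> \<open>The order bound gives the weak inequality. Equality would make both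
          exponents multiples of \<delta> with quotients adding up to \<open>2 * N - 1\<close>, a
          term recorded by the slice of \<open>d\<close>, which is zero.\<close>
        have "\<delta> * (2 * N - 1) < p' + q'"
        proof (rule ccontr)
          assume "\<not> ?thesis"
          moreover have "\<delta> * (2 * N - 1) \<le> \<delta> * (p' div \<delta>) + \<delta> * (q' div \<delta>)"
            using ge unfolding distrib_left[symmetric] by (rule mult_le_mono2)
          moreover have "\<delta> * (p' div \<delta>) \<le> p'" "\<delta> * (q' div \<delta>) \<le> q'" by simp_all
          ultimately have eq: "p' = \<delta> * (p' div \<delta>)" "q' = \<delta> * (q' div \<delta>)"
            "\<delta> * (p' div \<delta>) + \<delta> * (q' div \<delta>) = \<delta> * (2 * N - 1)" by linarith+
          then have sum: "p' div \<delta> + q' div \<delta> = 2 * N - 1"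
            unfolding distrib_left[symmetric] using \<delta> by simp
          have "Polynomial.coeff (slice \<delta> 0 0 (2 * N - 1) d) (q' div \<delta>) =
              bicoeff d (\<delta> * (p' div \<delta>)) (\<delta> * (q' div \<delta>))"
            unfolding sum[symmetric] by (simp add: coeff_slice)
          then show False using nz eq unfolding d_slice p'_def[symmetric] q'_def[symmetric] by simp
        qed
        then have "\<delta> * s + \<delta> * t < p' + q'" unfolding distrib_left[symmetric] st(1) .
        then have "i + j < p + q" using pq le unfolding p'_def q'_def by linarith
        moreover have "2 * N - 1 \<le> p div \<delta> + q div \<delta>"
          using ge div_le_mono[of p' p \<delta>] div_le_mono[of q' q \<delta>] by (simp add: p'_def q'_def)
        ultimately show "xy_monom p q \<in> J" using False by (intro less.hyps) auto
      qed
      moreover have "xy_monom (i - \<delta> * s) (j - \<delta> * t) * h \<in> J" by (rule J_mult[OF h(1)])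
      ultimately have "d * xy_monom (i - \<delta> * s) (j - \<delta> * t) + xy_monom (i - \<delta> * s) (j - \<delta> * t) * h \<in> J"
        using idJ unfolding ideal_type_iff by blast
      also have "d * xy_monom (i - \<delta> * s) (j - \<delta> * t) + xy_monom (i - \<delta> * s) (j - \<delta> * t) * h =
          xy_monom (i - \<delta> * s) (j - \<delta> * t) * xy_monom (\<delta> * s) (\<delta> * t)"
        by (simp add: d_def algebra_simps)
      also have "\<dots> = xy_monom i j" using le by (simp add: xy_monom_mult)
      finally show ?thesis .
    qed
  qed
  show ?thesis
    unfolding mono_ideal_def by (rule Idl_subset[OF idJ]) (use \<delta> in \<open>auto intro!: mem\<close>)
qed

section \<open>Two-generated reductions and the core\<close>

lemma Idl_two_elements:
  fixes f g :: "'a::comm_ring_1"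
  assumes "h \<in> Idl\<^bsub>ring_of_type_algebra\<^esub> {f, g}"
  obtains p q where "h = p * f + q * g"
proof -
  have "ideal {p * f + q * g | p q. True} ring_of_type_algebra"
    unfolding ideal_type_iff
  proof (intro conjI ballI allI)
    have "0 = 0 * f + 0 * g" by simp
    then show "0 \<in> {p * f + q * g | p q. True}" by blast
    fix a assume "a \<in> {p * f + q * g | p q. True}"
    then obtain p q where a: "a = p * f + q * g" by blast
    have "r * a = (r * p) * f + (r * q) * g" for r by (simp add: a algebra_simps)
    then show "r * a \<in> {p * f + q * g | p q. True}" for r by blast
    fix b assume "b \<in> {p * f + q * g | p q. True}"
    then obtain p' q' where b: "b = p' * f + q' * g" by blast
    have "a + b = (p + p') * f + (q + q') * g" by (simp add: a b algebra_simps)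
    then show "a + b \<in> {p * f + q * g | p q. True}" by blast
  qed
  moreover have "f = 1 * f + 0 * g" "g = 0 * f + 1 * g" by simp_all
  then have "{f, g} \<subseteq> {p * f + q * g | p q. True}" by blast
  ultimately have "Idl\<^bsub>ring_of_type_algebra\<^esub> {f, g} \<subseteq> {p * f + q * g | p q. True}"
    by (rule Idl_subset)
  then show thesis using assms that by blast
qed

lemma polys_on_degree: "p \<in> polys_on S \<Longrightarrow> S \<subseteq> {..d} \<Longrightarrow> Polynomial.degree p \<le> d"
  by (rule degree_le) (auto simp: polys_on_def)

text \<open>Homogenising the identity \<open>one\<close> puts \<open>X^(N (r + 1))\<close> into
  \<open>J\<close> times the \<open>r\<close>-th power; modulo \<open>f\<close> the same follows for
  \<open>Y^(N (r + 1))\<close>. A high power of any monomial generator contains one of these two as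
  a factor, so the criterion on powers of generators applies.\<close>

lemma two_generated_reduction:
  fixes c :: "'k::field"
  assumes N: "0 < N" and K: "K \<subseteq> {..N}" "0 \<in> K" "N \<in> K"
    and G: "G \<in> polys_on K" and w: "w \<in> polys_on (sumset_pow K r)" and Q: "Q \<in> polys_on (sumset_pow K r)"
    and one: "1 = (Polynomial.monom 1 N - [:c:]) * w + G * Q"
  shows "is_reduction ring_of_type_algebra (mono_ideal \<delta> N K)
    (Idl\<^bsub>ring_of_type_algebra\<^esub> {homogenize \<delta> N (Polynomial.monom 1 N - [:c:]), homogenize \<delta> N G})"
proof -
  let ?I = "mono_ideal \<delta> N K :: 'k poly poly set"
  let ?P = "ideal_power ring_of_type_algebra ?I"
  define F where "F = Polynomial.monom 1 N - [:c:]"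
  define f where "f = homogenize \<delta> N F"
  define g where "g = homogenize \<delta> N G"
  define J where "J = Idl\<^bsub>ring_of_type_algebra\<^esub> {f, g}"
  have idJ: "ideal J ring_of_type_algebra" by (simp add: J_def)
  have fgJ: "f \<in> J" "g \<in> J" by (auto simp: J_def intro: Idl_mem)
  have "Polynomial.monom 1 N \<in> polys_on K" "[:c:] \<in> polys_on K"
    using K by (simp_all flip: monom_0)
  then have F: "F \<in> polys_on K" unfolding F_def by (rule polys_on_simps(3))
  have "f \<in> ?I" "g \<in> ?I"
    unfolding f_def g_def
    using homogenize_mem[OF ideal_mono_ideal F mono_ideal_mem] homogenize_mem[OF ideal_mono_ideal G mono_ideal_mem]
    by blast+
  then have JI: "J \<subseteq> ?I" unfolding J_def by (intro Idl_subset) auto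
  define e0 eN :: "'k poly poly" where "e0 = xy_monom (\<delta> * N) 0" and "eN = xy_monom 0 (\<delta> * N)"
  have e0I: "e0 \<in> ?I" and eNI: "eN \<in> ?I"
    using mono_ideal_mem[OF K(2), of \<delta> N] mono_ideal_mem[OF K(3), of \<delta> N] by (simp_all add: e0_def eN_def)
  have hom_P: "homogenize \<delta> (N * r) p \<in> ?P r" if "p \<in> polys_on (sumset_pow K r)" for p
    unfolding mono_ideal_power[OF K(1)] using that
    by (intro homogenize_mem[OF ideal_mono_ideal] mono_ideal_mem)
  let ?L = "\<lambda>m. J \<cdot>\<^bsub>ring_of_type_algebra\<^esub> ?P m"
  have idL: "ideal (?L m) ring_of_type_algebra" for m
    by (intro ideal_prod_ideal ideal_power_ideal idJ ideal_mono_ideal)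
  have e0_pow: "e0 ^ Suc r \<in> ?L r"
  proof -
    have deg: "Polynomial.degree F \<le> N" "Polynomial.degree G \<le> N"
      "Polynomial.degree w \<le> N * r" "Polynomial.degree Q \<le> N * r"
      using polys_on_degree F G w Q K(1) sumset_pow_le[OF K(1)] by blast+
    \<comment> \<open>The constant 1 homogenises in degree \<open>N + N * r\<close> to
      \<open>e0 ^ Suc r\<close>.\<close>
    have "homogenize \<delta> (N + N * r) 1 = homogenize \<delta> (N + N * r) (Polynomial.monom 1 0)" by simp
    also have "\<dots> = [:[:1:]:] * xy_monom (\<delta> * (N + N * r)) 0" by (subst homogenize_monom) auto
    also have "\<dots> = e0 ^ Suc r" unfolding e0_def xy_monom_power by (simp add: distrib_left mult.assoc pCons_one)
    finally have "e0 ^ Suc r = homogenize \<delta> (N + N * r) (F * w + G * Q)"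
      unfolding F_def one[symmetric] by simp
    also have "\<dots> = f * homogenize \<delta> (N * r) w + g * homogenize \<delta> (N * r) Q"
      unfolding homogenize_add f_def g_def by (simp only: homogenize_mult deg)
    finally have e: "e0 ^ Suc r = \<dots>" .
    have "f * homogenize \<delta> (N * r) w \<in> ?L r" "g * homogenize \<delta> (N * r) Q \<in> ?L r"
      by (intro ideal_prod_mem fgJ hom_P w Q)+
    then show ?thesis unfolding e using idL[of r] unfolding ideal_type_iff by blast
  qed
  have f_eq: "f = eN - [:[:c:]:] * e0"
  proof -
    have neg: "[:- c:] = - [:c:]" by simp
    have "F = Polynomial.monom 1 N + Polynomial.monom (- c) 0" by (simp add: F_def monom_0)
    then have "f = homogenize \<delta> N (Polynomial.monom 1 N) + homogenize \<delta> N (Polynomial.monom (- c) 0)"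
      unfolding f_def by (simp only: homogenize_add)
    also have "\<dots> = [:[:1:]:] * xy_monom (\<delta> * (N - N)) (\<delta> * N) + [:[:- c:]:] * xy_monom (\<delta> * (N - 0)) (\<delta> * 0)"
      by (simp only: homogenize_monom order_refl le0)
    finally show ?thesis
      unfolding neg by (simp add: e0_def eN_def pCons_one del: minus_pCons)
  qed
  have eN_pow: "eN ^ Suc r \<in> ?L r"
  proof -
    \<comment> \<open>The cofactor of \<open>f = eN - c e0\<close> in the difference of the powers
      of \<open>eN\<close> and \<open>c e0\<close> with exponent \<open>Suc r\<close>.\<close>
    define z where "z = (\<Sum>i<Suc r. ([:[:c:]:] * e0) ^ (Suc r - Suc i) * eN ^ i)"
    have ce0: "[:[:c:]:] * e0 \<in> ?I"
      using e0I ideal_mono_ideal[of \<delta> N K] unfolding ideal_type_iff by blast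
    have "z \<in> ?P r" unfolding z_def
    proof (rule ideal_sum_mem[OF ideal_power_ideal[OF ideal_mono_ideal]])
      fix i assume "i \<in> {..<Suc r}"
      then have "Suc r - Suc i + i = r" by auto
      then show "([:[:c:]:] * e0) ^ (Suc r - Suc i) * eN ^ i \<in> ?P r"
        using ideal_power_mult_mem[OF ideal_mono_ideal ideal_power_power_mem[OF ideal_mono_ideal ce0]
          ideal_power_power_mem[OF ideal_mono_ideal eNI], of "Suc r - Suc i" i] by simp
    qed
    then have "f * z \<in> ?L r" by (intro ideal_prod_mem fgJ)
    moreover have "[:[:c:]:] ^ Suc r * e0 ^ Suc r \<in> ?L r"
      using idL[of r] e0_pow unfolding ideal_type_iff by blast
    ultimately have "f * z + [:[:c:]:] ^ Suc r * e0 ^ Suc r \<in> ?L r"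
      using idL[of r] unfolding ideal_type_iff by blast
    moreover have "eN ^ Suc r - ([:[:c:]:] * e0) ^ Suc r = f * z"
      unfolding f_eq z_def by (rule power_diff_sumr2)
    then have "eN ^ Suc r = f * z + [:[:c:]:] ^ Suc r * e0 ^ Suc r"
      by (simp only: power_mult_distrib diff_eq_eq)
    ultimately show ?thesis by simp
  qed
  \<comment> \<open>Raising to the power \<open>N\<close> turns a generator into a product of powers
    of \<open>e0\<close> and \<open>eN\<close>; the further factor \<open>M\<close> lifts the
    exponent \<open>(N - k) * M\<close> to at least \<open>Suc r\<close> whenever
    \<open>k < N\<close>.\<close>
  define M where "M = 2 * Suc r"
  have M_pos: "Suc (N * M - 1) = N * M" using N by (simp add: M_def)
  have "is_reduction ring_of_type_algebra ?I J"
  proof (rule is_reductionI_generators[where E = "N * M - 1"])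
    show "finite ((\<lambda>e. xy_monom (\<delta> * (N - e)) (\<delta> * e) :: 'k poly poly) ` K)"
      using finite_subset[OF K(1)] by simp
    show "?I = Idl\<^bsub>ring_of_type_algebra\<^esub> ((\<lambda>e. xy_monom (\<delta> * (N - e)) (\<delta> * e)) ` K)"
      by (rule mono_ideal_def)
    fix u :: "'k poly poly" assume "u \<in> (\<lambda>e. xy_monom (\<delta> * (N - e)) (\<delta> * e)) ` K"
    then obtain k where k: "k \<in> K" and u: "u = xy_monom (\<delta> * (N - k)) (\<delta> * k)" by blast
    have kN: "k \<le> N" using k K(1) by auto
    have uM: "u ^ (N * M) = e0 ^ ((N - k) * M) * eN ^ (k * M)"
      unfolding u e0_def eN_def xy_monom_power xy_monom_mult by (simp add: mult_ac)
    have split: "x ^ Suc r * (x ^ a * y ^ b) \<in> ?L (r + (a + b))"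
      if "x ^ Suc r \<in> ?L r" "x \<in> ?I" "y \<in> ?I" for x y a b
      using that by (intro ideal_prod_power_mult_mem ideal_power_mult_mem ideal_power_power_mem
          ideal_mono_ideal idJ)
    have "u ^ (N * M) \<in> ?L (N * M - 1)"
    proof (cases "k = N")
      case True
      have "eN ^ Suc r * (eN ^ (N * M - Suc r) * eN ^ 0) \<in> ?L (r + (N * M - Suc r + 0))"
        by (rule split[OF eN_pow eNI eNI])
      moreover have NM: "Suc r \<le> N * M" using N by (cases N) (auto simp: M_def)
      then have "r + (N * M - Suc r + 0) = N * M - 1" by simp
      moreover have "eN ^ Suc r * (eN ^ (N * M - Suc r) * eN ^ 0) = eN ^ (N * M)"
      proof -
        have "Suc r + (N * M - Suc r) + 0 = N * M" using NM by simp
        then show ?thesis by (simp only: mult.assoc power_add[symmetric] add.assoc)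
      qed
      ultimately show ?thesis unfolding uM using True by simp
    next
      case False
      have NM: "Suc r \<le> (N - k) * M"
      proof -
        have "1 * M \<le> (N - k) * M" using False kN by (intro mult_le_mono1) simp
        then show ?thesis by (simp add: M_def)
      qed
      have "(N - k) * M + k * M = N * M" using kN by (simp flip: distrib_right)
      then have "r + ((N - k) * M - Suc r + k * M) = N * M - 1" using NM by linarith
      moreover have "e0 ^ Suc r * (e0 ^ ((N - k) * M - Suc r) * eN ^ (k * M)) = u ^ (N * M)"
        unfolding uM mult.assoc[symmetric] power_add[symmetric] le_add_diff_inverse[OF NM] ..
      ultimately show ?thesis using split[OF e0_pow e0I eNI, of "(N - k) * M - Suc r" "k * M"] by simp
    qed
    then show "u ^ Suc (N * M - 1) \<in> ?L (N * M - 1)" unfolding M_pos .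
  qed (use idJ JI in auto)
  then show ?thesis unfolding J_def f_def g_def F_def .
qed

text \<open>For the upper bound, the exponents of \<open>h\<close> are sorted by their residues
  modulo \<delta>. Each slice of degree at most \<open>2 * N - 2\<close> is killed by the vanishing
  criterion, so only monomials with floors adding up to at least \<open>2 * N - 1\<close>
  survive.\<close>

lemma core_mono_ideal:
  fixes K :: "nat set"
  assumes inf: "infinite (UNIV :: 'k::field set)" and \<delta>: "0 < \<delta>" and N: "0 < N"
    and K: "K \<subseteq> {..N}" "0 \<in> K" "N \<in> K" "Gcd K = 1"
  shows "core ring_of_type_algebra (mono_ideal \<delta> N K :: 'k poly poly set) =
    mono_ideal \<delta> (2 * N - 1) {..2 * N - 1}"
proof
  show "mono_ideal \<delta> (2 * N - 1) {..2 * N - 1} \<subseteq> core ring_of_type_algebra (mono_ideal \<delta> N K :: 'k poly poly set)"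
    using mono_ideal_subset_reduction[OF \<delta> N K(1-3)] by (auto simp: core_def)
next
  let ?M = "mono_ideal \<delta> (2 * N - 1) {..2 * N - 1} :: 'k poly poly set"
  show "core ring_of_type_algebra (mono_ideal \<delta> N K) \<subseteq> ?M"
  proof
    fix h :: "'k poly poly" assume h: "h \<in> core ring_of_type_algebra (mono_ideal \<delta> N K)"
    show "h \<in> ?M"
    proof (rule ideal_mem_if_monomials[OF ideal_mono_ideal])
      fix i j assume nz: "bicoeff h i j \<noteq> 0"
      define a b where "a = i mod \<delta>" and "b = j mod \<delta>"
      define i' j' where "i' = i div \<delta>" and "j' = j div \<delta>"
      have ij: "i = a + \<delta> * i'" "j = b + \<delta> * j'" and ab: "a < \<delta>" "b < \<delta>"
        using \<delta> by (simp_all add: a_def b_def i'_def j'_def)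
      have "2 * N - 1 \<le> i' + j'"
      proof (rule ccontr)
        assume "\<not> ?thesis"
        then have small: "i' + j' \<le> N + (N - 2)" "i' + j' < 2 * N - 1" by auto
        define e where "e = i' + j'"
        have "slice \<delta> a b e h = 0"
        proof (rule vanishing_criterion[OF inf N K])
          fix c \<sigma> :: 'k and v w Q :: "'k poly" and r
          assume v: "v \<in> polys_on K" and w: "w \<in> polys_on (sumset_pow K r)"
            and Q: "Q \<in> polys_on (sumset_pow K r)"
            and one: "1 = (Polynomial.monom 1 N - [:c:]) * w + (1 - Polynomial.smult \<sigma> v) * Q"
          define F where "F = Polynomial.monom 1 N - [:c:]"
          define G where "G = 1 - Polynomial.smult \<sigma> v"
          have "Polynomial.monom 1 0 \<in> polys_on K" by (rule polys_on_simps(5)[OF K(2)])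
          then have "(1 :: 'k poly) \<in> polys_on K" unfolding monom_0 one_pCons .
          then have G: "G \<in> polys_on K" unfolding G_def using v by (intro polys_on_simps(3,4))
          have degG: "Polynomial.degree G \<le> N" using polys_on_degree[OF G K(1)] .
          have degF: "Polynomial.degree F \<le> N" unfolding F_def degree_binomial[OF N] by simp
          \<comment> \<open>The identity \<open>one\<close> certifies that the two forms generate a
            reduction, and the core lies in every reduction.\<close>
          have "h \<in> Idl\<^bsub>ring_of_type_algebra\<^esub> {homogenize \<delta> N F, homogenize \<delta> N G}"
            using two_generated_reduction[OF N K(1-3) G w Q one[folded G_def]] h
            unfolding core_def F_def by blast
          then obtain p q where pq: "h = p * homogenize \<delta> N F + q * homogenize \<delta> N G"
            by (rule Idl_two_elements)
          \<comment> \<open>The cofactor slice has degree \<open>e - N\<close>, which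
            \<open>e < 2 * N - 1\<close> bounds by \<open>N - 2\<close>; for \<open>e < N\<close> it
            is zero. This is the degree bound on \<open>B\<close> demanded by the criterion.\<close>
          let ?s = "\<lambda>p. if N \<le> e then slice \<delta> a b (e - N) p else 0"
          have "slice \<delta> a b e h = F * ?s p + G * ?s q"
            unfolding pq slice_simps slice_mult_homogenize[OF ab degF] slice_mult_homogenize[OF ab degG]
            by simp
          moreover have "Polynomial.coeff (?s q) m = 0" if "m \<ge> N - 1" for m
            using that small by (auto simp: coeff_slice e_def)
          ultimately show "\<exists>A B. slice \<delta> a b e h = (Polynomial.monom 1 N - [:c:]) * A +
              (1 - Polynomial.smult \<sigma> v) * B \<and> (\<forall>i\<ge>N - 1. Polynomial.coeff B i = 0)"
            unfolding F_def G_def by blast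
        qed
        then have "Polynomial.coeff (slice \<delta> a b e h) j' = 0" by simp
        then show False using nz by (simp add: coeff_slice e_def ij)
      qed
      define t where "t = min j' (2 * N - 1)"
      define s where "s = 2 * N - 1 - t"
      have st: "s \<le> i'" "t \<le> j'" using \<open>2 * N - 1 \<le> i' + j'\<close> by (auto simp: s_def t_def)
      have "xy_monom (\<delta> * s) (\<delta> * t) \<in> ?M"
        using mono_ideal_mem[of t "{..2 * N - 1}" \<delta> "2 * N - 1"] by (simp add: s_def t_def)
      then have "xy_monom (i - \<delta> * s) (j - \<delta> * t) * xy_monom (\<delta> * s) (\<delta> * t) \<in> ?M"
        using ideal_mono_ideal[of \<delta> "2 * N - 1" "{..2 * N - 1}"] unfolding ideal_type_iff by blast
      moreover have "\<delta> * s \<le> i" "\<delta> * t \<le> j"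
        using st by (simp_all add: ij trans_le_add2)
      ultimately show "xy_monom i j \<in> ?M" by (simp add: xy_monom_mult)
    qed
  qed
qed

section \<open>Passage to the given generators\<close>

lemma sumset_pow_0_1: "sumset_pow {0, 1} m = {..m}"
proof (induction m)
  case (Suc m)
  have "{e + k | e k. e \<in> {..m} \<and> k \<in> {0, 1 :: nat}} = {..Suc m}"
  proof
    show "{..Suc m} \<subseteq> {e + k | e k. e \<in> {..m} \<and> k \<in> {0, 1}}"
    proof
      fix x assume "x \<in> {..Suc m}"
      then have "x = x + 0 \<and> x \<le> m \<or> x = m + 1" by auto
      then show "x \<in> {e + k | e k. e \<in> {..m} \<and> k \<in> {0, 1}}" by blast
    qed
  qed auto
  then show ?case using Suc by simp
qed auto

text \<open>The ideal \<open>(x^\<delta>, y^\<delta>)\<close> is the monomial ideal with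
  \<open>N = 1\<close> and \<open>K = {0, 1}\<close>, whose \<open>m\<close>-fold sumset is the full
  interval.\<close>

lemma ideal_power_var_powers:
  "ideal_power ring_of_type_algebra (Idl\<^bsub>ring_of_type_algebra\<^esub> {var_x ^ \<delta>, var_y ^ \<delta> :: 'k::field poly poly}) m =
    mono_ideal \<delta> m {..m}"
proof -
  have "(\<lambda>e. xy_monom (\<delta> * (1 - e)) (\<delta> * e)) ` {0, 1} = {var_x ^ \<delta>, var_y ^ \<delta> :: 'k poly poly}"
    by (simp add: xy_monom_def)
  then have "Idl\<^bsub>ring_of_type_algebra\<^esub> {var_x ^ \<delta>, var_y ^ \<delta> :: 'k poly poly} = mono_ideal \<delta> 1 {0, 1}"
    unfolding mono_ideal_def by simp
  then show ?thesis
    using mono_ideal_power[of "{0, 1}" 1 \<delta> m, where 'k = 'k] by (simp add: sumset_pow_0_1[unfolded One_nat_def])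
qed

theorem theorem6p4:
  fixes \<mu> :: "'k::field poly poly"
    and I :: "'k poly poly set"
    and n s a b \<delta> :: nat
    and k :: "nat \<Rightarrow> nat"
  assumes "infinite (UNIV :: 'k set)"
    and "0 < n"
    and "strict_mono_on {1..s} k"
    and "\<And>i. i \<in> {1..s} \<Longrightarrow> 0 < k i \<and> k i < n"
    and "\<mu> = var_x ^ a * var_y ^ b"
    and "I = \<mu> <#\<^bsub>bipoly_ring\<^esub>
               Idl\<^bsub>bipoly_ring\<^esub> ({var_x ^ n, var_y ^ n} \<union>
                 {var_x ^ (n - k i) * var_y ^ k i | i. i \<in> {1..s}})"
    and "\<delta> = Gcd (insert n (k ` {1..s}))"
  shows "core bipoly_ring I =
           \<mu> <#\<^bsub>bipoly_ring\<^esub>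
             ideal_power bipoly_ring
               (Idl\<^bsub>bipoly_ring\<^esub> {var_x ^ \<delta>, var_y ^ \<delta>}) (2 * (n div \<delta>) - 1)"
proof -
  define N where "N = n div \<delta>"
  \<comment> \<open>The elements 0 and \<open>N\<close> come from the generators \<open>x^n\<close>
    and \<open>y^n\<close>.\<close>
  define K where "K = insert 0 (insert N ((\<lambda>i. k i div \<delta>) ` {1..s}))"
  have dvd_n: "\<delta> dvd n" and dvd_k: "\<And>i. i \<in> {1..s} \<Longrightarrow> \<delta> dvd k i"
    unfolding assms(7) by (intro Gcd_dvd; simp)+
  have \<delta>: "0 < \<delta>" using dvd_n assms(2) by (auto intro: Nat.gr0I)
  have n: "n = \<delta> * N" using dvd_n by (simp add: N_def)
  have k: "k i = \<delta> * (k i div \<delta>)" if "i \<in> {1..s}" for i using dvd_k[OF that] by simp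
  have N: "0 < N" using n assms(2) by (auto intro: Nat.gr0I)
  have "k i div \<delta> \<le> N" if "i \<in> {1..s}" for i
    unfolding N_def using assms(4)[OF that] by (intro div_le_mono) simp
  then have K_le: "K \<subseteq> {..N}" unfolding K_def by blast
  have "k ` {1..s} = (*) \<delta> ` ((\<lambda>i. k i div \<delta>) ` {1..s})"
    unfolding image_image using k by (intro image_cong refl)
  then have "insert n (k ` {1..s}) = (*) \<delta> ` insert N ((\<lambda>i. k i div \<delta>) ` {1..s})"
    unfolding image_insert n[symmetric] by (rule arg_cong)
  \<comment> \<open>Taking \<delta> out of the gcd leaves gcd 1 for the quotients; the additional
    element 0 of \<open>K\<close> does not affect a gcd.\<close>
  then have "\<delta> = \<delta> * Gcd (insert N ((\<lambda>i. k i div \<delta>) ` {1..s}))"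
    using assms(7) by (metis Gcd_mult normalize_nat_def id_apply)
  then have Gcd: "Gcd K = 1" using \<delta> by (simp add: K_def)
  have "(\<lambda>e. xy_monom (\<delta> * (N - e)) (\<delta> * e) :: 'k poly poly) ` K = {var_x ^ n, var_y ^ n} \<union>
      {var_x ^ (n - k i) * var_y ^ k i | i. i \<in> {1..s}}"
  proof -
    have "xy_monom (\<delta> * (N - k i div \<delta>)) (\<delta> * (k i div \<delta>)) =
        (var_x ^ (n - k i) * var_y ^ k i :: 'k poly poly)" if "i \<in> {1..s}" for i
      using n k[OF that] by (simp add: xy_monom_def diff_mult_distrib2)
    then have "(\<lambda>e. xy_monom (\<delta> * (N - e)) (\<delta> * e) :: 'k poly poly) ` ((\<lambda>i. k i div \<delta>) ` {1..s}) =
        {var_x ^ (n - k i) * var_y ^ k i | i. i \<in> {1..s}}"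
      unfolding image_image Setcompr_eq_image by (intro image_cong refl)
    then show ?thesis unfolding K_def by (simp add: xy_monom_def n)
  qed
  then have I: "I = (*) \<mu> ` mono_ideal \<delta> N K"
    unfolding assms(6) mono_ideal_def l_coset_type_eq by simp
  have "xy_monom a b = Polynomial.monom (Polynomial.monom (1 :: 'k) a) b" by (rule xy_monom_conv)
  then have \<mu>: "\<mu> \<noteq> 0" unfolding assms(5) xy_monom_def[symmetric] by (simp add: monom_eq_0_iff)
  have "core bipoly_ring I = (*) \<mu> ` core ring_of_type_algebra (mono_ideal \<delta> N K)"
    unfolding I by (rule core_scale[OF \<mu> ideal_mono_ideal])
  also have "core ring_of_type_algebra (mono_ideal \<delta> N K :: 'k poly poly set) =
      mono_ideal \<delta> (2 * N - 1) {..2 * N - 1}"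
    by (rule core_mono_ideal[OF assms(1) \<delta> N K_le _ _ Gcd]) (simp_all add: K_def)
  finally show ?thesis
    unfolding ideal_power_var_powers l_coset_type_eq N_def .
qed

end
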